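(* Let $A$ be a unital separable C*-algebra, $H$ a separable Hilbert space, $G$ a group, and $\tau : G \to \mathrm{Aut}(A)$ an action of $G$ on $A$ by *-automorphisms. Let $\phi \in \mathrm{UCP}^G_A(H)$ and let $\mu \in \mathcal{O}_\phi(\mathrm{UCP}_A(H))$ be a (generalized) orthogonal measure with barycenter $\phi$. Then $\mu$ satisfies $$\int_{\mathrm{UCP}_A(H)} f(\phi') \langle \phi'(\tau_{g^{-1}}(ab))h_1, h_2\rangle \, d\mu(\phi') = \int_{\mathrm{UCP}_A(H)} f(\phi') \langle \phi'(ab)h_1, h_2\rangle \, d\mu(\phi')$$ for all $a,b \in A$, $h_1,h_2 \in H$, $g \in G$ and $f \in L^\infty(\mathrm{UCP}_A(H),\mu)$ if and only if the support of $\mu$ is contained in $\mathrm{UCP}^G_A(H)$. Moreover, if the measure $\mu$ is maximal in $M_\phi(\mathrm{UCP}_A(H))$, then $\mu$ is supported on $\mathrm{ext}(\mathrm{UCP}^G_A(H))$, the set of extreme points of $\mathrm{UCP}^G_A(H)$.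
   Context: $\mathrm{UCP}_A(H)$ is the set of all unital completely positive (UCP) maps $A \to B(H)$, with the BW topology (in which $\phi_\alpha \to \phi$ iff $\langle \phi_\alpha(a)h_1,h_2\rangle \to \langle \phi(a)h_1,h_2\rangle$ for all $a\in A$, $h_1,h_2\in H$); it is compact and convex. $\mathrm{UCP}^G_A(H)$ is the compact convex subset of those $\phi\in\mathrm{UCP}_A(H)$ with $\phi(\tau_g(a)) = \phi(a)$ for all $g\in G$, $a\in A$. $M_\phi(\mathrm{UCP}_A(H))$ is the set of Borel probability measures $\mu$ on $\mathrm{UCP}_A(H)$ with barycenter $\phi$, i.e. $\langle\phi(a)h_1,h_2\rangle = \int \langle \phi'(a)h_1,h_2\rangle\, d\mu(\phi')$ for all $a\in A$, $h_1,h_2\in H$. "Maximal" refers to the usual (Choquet) order on measures: $\mu\succ\nu$ iff $\int F\,d\mu\ge\int F\,d\nu$ for every real continuous convex function $F$ on $\mathrm{UCP}_A(H)$. "Supported on $S$" for a Borel set $S$ (here the set of extreme points) means $\mu(S)=1$. Minimal Stinespring dilation of a completely positive $\psi: A\to B(H)$: a Hilbert space $K$, a bounded linear $V: H\to K$ and a unital *-representation $\rho: A\to B(K)$ with $\psi(a)=V^*\rho(a)V$ and $\overline{\mathrm{span}}\,\rho(A)VH = K$; $\rho(A)'$ denotes the commutant of $\rho(A)$ in $B(K)$. Completely positive maps $\phi_1,\phi_2:A\to B(H)$ satisfy $\phi_1\perp\phi_2$ if, with $V^*\rho V$ the minimal Stinespring dilation of $\phi_1+\phi_2$, there is a projection $P\in\rho(A)'$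 with $\phi_1 = V^*P\rho V$ and $\phi_2 = V^*(1-P)\rho V$. A measure $\mu\in M_\phi(\mathrm{UCP}_A(H))$ is a (generalized) orthogonal measure if for every Borel set $E\subseteq \mathrm{UCP}_A(H)$ one has $\int_E \phi'\,d\mu \perp \int_{\mathrm{UCP}_A(H)\setminus E}\phi'\,d\mu$ (weak integrals). The set of such measures is $\mathcal{O}_\phi(\mathrm{UCP}_A(H))$.
   Formalization: In the "Moreover" part, the support of μ is also assumed to be contained in UCP^G_A(H); without this it fails (A = C², H = C, G = Z/2 swapping coordinates, φ the uniform state, μ the average of the point masses at the two pure states). *)

theory Defs
  imports "HOL-Probability.Probability" "HOL-Algebra.Module"
begin

section \<open>Complex Banach spaces, C*-algebras, Hilbert spaces\<close>

class complex_banach = banach +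
  fixes scaleC :: "complex \<Rightarrow> 'a \<Rightarrow> 'a" (infixr "*\<^sub>C" 75)
  assumes scaleC_add_right: "c *\<^sub>C (x + y) = c *\<^sub>C x + c *\<^sub>C y"
    and scaleC_add_left: "(c + d) *\<^sub>C x = c *\<^sub>C x + d *\<^sub>C x"
    and scaleC_scaleC: "c *\<^sub>C (d *\<^sub>C x) = (c * d) *\<^sub>C x"
    and scaleC_of_real: "complex_of_real r *\<^sub>C x = r *\<^sub>R x"
    and norm_scaleC: "norm (c *\<^sub>C x) = cmod c * norm x"

text \<open>Unital C*-algebras. Only \<^class>\<open>monoid_mult\<close> is required for the unit, so the zero algebra
  is not excluded; \<open>norm 1 = 1\<close> otherwise follows from the C*-identity.\<close>

class unital_cstar_algebra = complex_banach + real_normed_algebra + monoid_mult +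
  fixes star :: "'a \<Rightarrow> 'a"
  assumes scaleC_mult_left: "(c *\<^sub>C x) * y = c *\<^sub>C (x * y)"
    and scaleC_mult_right: "x * (c *\<^sub>C y) = c *\<^sub>C (x * y)"
    and star_star: "star (star x) = x"
    and star_add: "star (x + y) = star x + star y"
    and star_scaleC: "star (c *\<^sub>C x) = cnj c *\<^sub>C star x"
    and star_mult: "star (x * y) = star y * star x"
    and cstar_identity: "norm (star x * x) = (norm x)\<^sup>2"

text \<open>The inner product is linear in its first argument.\<close>

class complex_hilbert = complex_banach +
  fixes cinner :: "'a \<Rightarrow> 'a \<Rightarrow> complex"
  assumes cinner_commute: "cinner y x = cnj (cinner x y)"
    and cinner_add_left: "cinner (x + y) z = cinner x z + cinner y z"
    and cinner_scaleC_left: "cinner (c *\<^sub>C x) y = c * cinner x y"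
    and cinner_self: "cinner x x = complex_of_real ((norm x)\<^sup>2)"

definition clinear :: "('a::complex_banach \<Rightarrow> 'b::complex_banach) \<Rightarrow> bool" where
  "clinear T \<longleftrightarrow> (\<forall>x y. T (x + y) = T x + T y) \<and> (\<forall>c x. T (c *\<^sub>C x) = c *\<^sub>C T x)"

definition bounded_clinear :: "('a::complex_banach \<Rightarrow> 'b::complex_banach) \<Rightarrow> bool" where
  "bounded_clinear T \<longleftrightarrow> clinear T \<and> (\<exists>C. \<forall>x. norm (T x) \<le> C * norm x)"

definition star_automorphism :: "('a::unital_cstar_algebra \<Rightarrow> 'a) \<Rightarrow> bool" where
  "star_automorphism t \<longleftrightarrow>
     clinear t \<and> (\<forall>a b. t (a * b) = t a * t b) \<and> (\<forall>a. t (star a) = star (t a)) \<and> bij t"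

definition action_by_automorphisms ::
  "('g, 'm) monoid_scheme \<Rightarrow> ('g \<Rightarrow> 'a::unital_cstar_algebra \<Rightarrow> 'a) \<Rightarrow> bool" where
  "action_by_automorphisms G \<tau> \<longleftrightarrow>
     (\<forall>g\<in>carrier G. star_automorphism (\<tau> g)) \<and>
     (\<forall>g\<in>carrier G. \<forall>h\<in>carrier G. \<tau> (g \<otimes>\<^bsub>G\<^esub> h) = \<tau> g \<circ> \<tau> h)"


section \<open>Completely positive maps\<close>

text \<open>An \<open>n \<times> n\<close> matrix over \<open>A\<close> is a function of two indices, of which only the values at indices
  below \<open>n\<close> matter. A positive element of the C*-algebra \<open>M\<^sub>n(A)\<close> is one of the form \<open>Y\<^sup>* Y\<close>.\<close>

definition positive_matrix :: "nat \<Rightarrow> (nat \<Rightarrow> nat \<Rightarrow> 'a::unital_cstar_algebra) \<Rightarrow> bool" where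
  "positive_matrix n X \<longleftrightarrow>
     (\<exists>Y. \<forall>i<n. \<forall>j<n. X i j = (\<Sum>k<n. star (Y k i) * Y k j))"

text \<open>Positivity of an \<open>n \<times> n\<close> matrix of operators, regarded as an operator on \<open>H\<^sup>n\<close>.\<close>

definition positive_operator_matrix :: "nat \<Rightarrow> (nat \<Rightarrow> nat \<Rightarrow> 'h::complex_hilbert \<Rightarrow> 'h) \<Rightarrow> bool" where
  "positive_operator_matrix n T \<longleftrightarrow>
     (\<forall>h. (\<Sum>i<n. cinner (\<Sum>j<n. T i j (h j)) (h i)) \<in> \<real>\<^sub>\<ge>\<^sub>0)"

definition completely_positive :: "('a::unital_cstar_algebra \<Rightarrow> 'h::complex_hilbert \<Rightarrow> 'h) \<Rightarrow> bool" where
  "completely_positive \<phi> \<longleftrightarrow>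
     (\<forall>a. bounded_clinear (\<phi> a)) \<and>
     (\<forall>a b h. \<phi> (a + b) h = \<phi> a h + \<phi> b h) \<and>
     (\<forall>c a h. \<phi> (c *\<^sub>C a) h = c *\<^sub>C \<phi> a h) \<and>
     (\<forall>n X. positive_matrix n X \<longrightarrow> positive_operator_matrix n (\<lambda>i j. \<phi> (X i j)))"

definition UCP :: "('a::unital_cstar_algebra \<Rightarrow> 'h::complex_hilbert \<Rightarrow> 'h) set" where
  "UCP = {\<phi>. completely_positive \<phi> \<and> \<phi> 1 = id}"

definition UCP_inv :: "('g, 'm) monoid_scheme \<Rightarrow> ('g \<Rightarrow> 'a \<Rightarrow> 'a) \<Rightarrow>
    ('a::unital_cstar_algebra \<Rightarrow> 'h::complex_hilbert \<Rightarrow> 'h) set" where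
  "UCP_inv G \<tau> = {\<phi> \<in> UCP. \<forall>g\<in>carrier G. \<forall>a. \<phi> (\<tau> g a) = \<phi> a}"

text \<open>The BW topology: the initial topology on \<^const>\<open>UCP\<close> for all the functions
  \<open>\<phi> \<mapsto> \<langle>\<phi>(a)h\<^sub>1,h\<^sub>2\<rangle>\<close>.\<close>

definition BW :: "('a::unital_cstar_algebra \<Rightarrow> 'h::complex_hilbert \<Rightarrow> 'h) topology" where
  "BW = pullback_topology UCP (\<lambda>\<phi> (a, h1, h2). cinner (\<phi> a h1) h2)
          (product_topology (\<lambda>_. euclidean) UNIV)"

lemma topspace_BW: "topspace BW = UCP"
  by (simp add: BW_def topspace_pullback_topology)

definition convex_comb :: "real \<Rightarrow> ('a \<Rightarrow> 'h \<Rightarrow> 'h) \<Rightarrow> ('a \<Rightarrow> 'h \<Rightarrow> 'h) \<Rightarrow> 'a \<Rightarrow> 'h::real_vector \<Rightarrow> 'h" where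
  "convex_comb t \<phi> \<psi> = (\<lambda>a h. t *\<^sub>R \<phi> a h + (1 - t) *\<^sub>R \<psi> a h)"

definition extreme_points :: "('a \<Rightarrow> 'h \<Rightarrow> 'h::real_vector) set \<Rightarrow> ('a \<Rightarrow> 'h \<Rightarrow> 'h) set" where
  "extreme_points S = {\<phi> \<in> S. \<forall>\<phi>1\<in>S. \<forall>\<phi>2\<in>S. \<forall>t. 0 < t \<and> t < 1 \<and> \<phi> = convex_comb t \<phi>1 \<phi>2
     \<longrightarrow> \<phi>1 = \<phi> \<and> \<phi>2 = \<phi>}"


section \<open>Measures on the space of UCP maps\<close>

definition measures_with_barycenter :: "('a::unital_cstar_algebra \<Rightarrow> 'h::complex_hilbert \<Rightarrow> 'h) \<Rightarrow>
    ('a \<Rightarrow> 'h \<Rightarrow> 'h) measure set" where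
  "measures_with_barycenter \<phi> = {\<mu>.
     prob_space \<mu> \<and> space \<mu> = UCP \<and> sets \<mu> = sigma_sets UCP {U. openin BW U} \<and>
     (\<forall>a h1 h2. cinner (\<phi> a h1) h2 = (LINT \<phi>'|\<mu>. cinner (\<phi>' a h1) h2))}"

definition convex_on_UCP :: "(('a::unital_cstar_algebra \<Rightarrow> 'h::complex_hilbert \<Rightarrow> 'h) \<Rightarrow> real) \<Rightarrow> bool" where
  "convex_on_UCP F \<longleftrightarrow> (\<forall>\<phi>\<in>UCP. \<forall>\<psi>\<in>UCP. \<forall>t. 0 \<le> t \<and> t \<le> 1 \<longrightarrow>
     F (convex_comb t \<phi> \<psi>) \<le> t * F \<phi> + (1 - t) * F \<psi>)"

definition choquet_ge :: "('a::unital_cstar_algebra \<Rightarrow> 'h::complex_hilbert \<Rightarrow> 'h) measure \<Rightarrow>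
    ('a \<Rightarrow> 'h \<Rightarrow> 'h) measure \<Rightarrow> bool" where
  "choquet_ge \<mu> \<nu> \<longleftrightarrow> (\<forall>F. continuous_map BW euclideanreal F \<and> convex_on_UCP F \<longrightarrow>
     (LINT \<phi>|\<nu>. F \<phi>) \<le> (LINT \<phi>|\<mu>. F \<phi>))"

definition choquet_maximal :: "('a::unital_cstar_algebra \<Rightarrow> 'h::complex_hilbert \<Rightarrow> 'h) \<Rightarrow>
    ('a \<Rightarrow> 'h \<Rightarrow> 'h) measure \<Rightarrow> bool" where
  "choquet_maximal \<phi> \<mu> \<longleftrightarrow> \<mu> \<in> measures_with_barycenter \<phi> \<and>
     (\<forall>\<nu>\<in>measures_with_barycenter \<phi>. choquet_ge \<nu> \<mu> \<longrightarrow> \<nu> = \<mu>)"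

definition measure_support :: "('a::unital_cstar_algebra \<Rightarrow> 'h::complex_hilbert \<Rightarrow> 'h) measure \<Rightarrow>
    ('a \<Rightarrow> 'h \<Rightarrow> 'h) set" where
  "measure_support \<mu> = {\<phi> \<in> UCP. \<forall>U. openin BW U \<and> \<phi> \<in> U \<longrightarrow> 0 < emeasure \<mu> U}"

definition supported_on :: "'x measure \<Rightarrow> 'x set \<Rightarrow> bool" where
  "supported_on \<mu> S \<longleftrightarrow> S \<in> sets \<mu> \<and> emeasure \<mu> S = 1"

text \<open>Representatives of the elements of the complex space \<open>L\<^sup>\<infinity>(\<mu>)\<close>.\<close>

definition L_infinity :: "'x measure \<Rightarrow> ('x \<Rightarrow> complex) set" where
  "L_infinity \<mu> = {f \<in> borel_measurable \<mu>. \<exists>C. AE x in \<mu>. cmod (f x) \<le> C}"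


section \<open>Minimal Stinespring dilations and orthogonality\<close>

text \<open>The dilation space is existentially quantified inside the definition of orthogonality, so it
  cannot be a type; it is a complex Hilbert space on an explicit carrier. The multiplication of the
  underlying ring record is unused, as for all modules in HOL-Algebra.\<close>

record 'k hilbert_space = "(complex, 'k) module" +
  ip :: "'k \<Rightarrow> 'k \<Rightarrow> complex"

definition complex_ring :: "complex ring" where
  "complex_ring = \<lparr>carrier = UNIV, mult = (*), one = 1, zero = 0, add = (+)\<rparr>"

definition hnorm :: "'k hilbert_space \<Rightarrow> 'k \<Rightarrow> real" where
  "hnorm K x = sqrt (Re (ip K x x))"

definition is_hilbert_space :: "'k hilbert_space \<Rightarrow> bool" where
  "is_hilbert_space K \<longleftrightarrow>
     Module.module complex_ring K \<and>
     (\<forall>x\<in>carrier K. \<forall>y\<in>carrier K. ip K y x = cnj (ip K x y)) \<and>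
     (\<forall>x\<in>carrier K. \<forall>y\<in>carrier K. \<forall>z\<in>carrier K. ip K (x \<oplus>\<^bsub>K\<^esub> y) z = ip K x z + ip K y z) \<and>
     (\<forall>c. \<forall>x\<in>carrier K. \<forall>y\<in>carrier K. ip K (c \<odot>\<^bsub>K\<^esub> x) y = c * ip K x y) \<and>
     (\<forall>x\<in>carrier K. x \<noteq> \<zero>\<^bsub>K\<^esub> \<longrightarrow> 0 < Re (ip K x x)) \<and>
     (\<forall>X. (\<forall>n::nat. X n \<in> carrier K) \<and>
          (\<forall>e>0. \<exists>N. \<forall>m\<ge>N. \<forall>n\<ge>N. hnorm K (X m \<ominus>\<^bsub>K\<^esub> X n) < e) \<longrightarrow>
          (\<exists>x\<in>carrier K. (\<lambda>n. hnorm K (X n \<ominus>\<^bsub>K\<^esub> x)) \<longlonglongrightarrow> 0))"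

definition bounded_operators :: "'k hilbert_space \<Rightarrow> ('k \<Rightarrow> 'k) set" where
  "bounded_operators K = {T \<in> carrier K \<rightarrow> carrier K.
     (\<forall>x\<in>carrier K. \<forall>y\<in>carrier K. T (x \<oplus>\<^bsub>K\<^esub> y) = T x \<oplus>\<^bsub>K\<^esub> T y) \<and>
     (\<forall>c. \<forall>x\<in>carrier K. T (c \<odot>\<^bsub>K\<^esub> x) = c \<odot>\<^bsub>K\<^esub> T x) \<and>
     (\<exists>C. \<forall>x\<in>carrier K. hnorm K (T x) \<le> C * hnorm K x)}"

text \<open>Bounded linear maps from the Hilbert space \<open>H\<close>, given as a type, into \<open>K\<close>, and the relation
  \<open>W = V\<^sup>*\<close> for such a map.\<close>

definition bounded_maps_into :: "'k hilbert_space \<Rightarrow> ('h::complex_hilbert \<Rightarrow> 'k) set" where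
  "bounded_maps_into K = {V \<in> UNIV \<rightarrow> carrier K.
     (\<forall>h1 h2. V (h1 + h2) = V h1 \<oplus>\<^bsub>K\<^esub> V h2) \<and>
     (\<forall>c h. V (c *\<^sub>C h) = c \<odot>\<^bsub>K\<^esub> V h) \<and>
     (\<exists>C. \<forall>h. hnorm K (V h) \<le> C * norm h)}"

definition is_adjoint :: "'k hilbert_space \<Rightarrow> ('h::complex_hilbert \<Rightarrow> 'k) \<Rightarrow> ('k \<Rightarrow> 'h) \<Rightarrow> bool" where
  "is_adjoint K V W \<longleftrightarrow> (\<forall>h. \<forall>x\<in>carrier K. ip K (V h) x = cinner h (W x))"

definition unital_star_rep :: "'k hilbert_space \<Rightarrow> ('a::unital_cstar_algebra \<Rightarrow> 'k \<Rightarrow> 'k) \<Rightarrow> bool" where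
  "unital_star_rep K \<rho> \<longleftrightarrow>
     (\<forall>a. \<rho> a \<in> bounded_operators K) \<and>
     (\<forall>x\<in>carrier K.
        (\<forall>a b. \<rho> (a + b) x = \<rho> a x \<oplus>\<^bsub>K\<^esub> \<rho> b x) \<and>
        (\<forall>c a. \<rho> (c *\<^sub>C a) x = c \<odot>\<^bsub>K\<^esub> \<rho> a x) \<and>
        (\<forall>a b. \<rho> (a * b) x = \<rho> a (\<rho> b x)) \<and>
        \<rho> 1 x = x \<and>
        (\<forall>a. \<forall>y\<in>carrier K. ip K (\<rho> a x) y = ip K x (\<rho> (star a) y)))"

definition hspan :: "'k hilbert_space \<Rightarrow> 'k set \<Rightarrow> 'k set" where
  "hspan K S = \<Inter>{N. submodule N complex_ring K \<and> S \<subseteq> N}"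

definition hdense :: "'k hilbert_space \<Rightarrow> 'k set \<Rightarrow> bool" where
  "hdense K S \<longleftrightarrow> (\<forall>x\<in>carrier K. \<forall>e>0. \<exists>y\<in>S. hnorm K (x \<ominus>\<^bsub>K\<^esub> y) < e)"

text \<open>\<open>K, V, \<rho>\<close> form a minimal Stinespring dilation of \<open>\<psi>\<close>, with \<open>W = V\<^sup>*\<close>.\<close>

definition minimal_stinespring :: "'k hilbert_space \<Rightarrow> ('h::complex_hilbert \<Rightarrow> 'k) \<Rightarrow> ('k \<Rightarrow> 'h) \<Rightarrow>
    ('a::unital_cstar_algebra \<Rightarrow> 'k \<Rightarrow> 'k) \<Rightarrow> ('a \<Rightarrow> 'h \<Rightarrow> 'h) \<Rightarrow> bool" where
  "minimal_stinespring K V W \<rho> \<psi> \<longleftrightarrow>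
     is_hilbert_space K \<and> V \<in> bounded_maps_into K \<and> is_adjoint K V W \<and> unital_star_rep K \<rho> \<and>
     (\<forall>a h. \<psi> a h = W (\<rho> a (V h))) \<and>
     hdense K (hspan K {\<rho> a (V h) | a h. True})"

definition projection_in_commutant :: "'k hilbert_space \<Rightarrow>
    ('a::unital_cstar_algebra \<Rightarrow> 'k \<Rightarrow> 'k) \<Rightarrow> ('k \<Rightarrow> 'k) \<Rightarrow> bool" where
  "projection_in_commutant K \<rho> P \<longleftrightarrow>
     P \<in> bounded_operators K \<and>
     (\<forall>x\<in>carrier K. P (P x) = P x) \<and>
     (\<forall>x\<in>carrier K. \<forall>y\<in>carrier K. ip K (P x) y = ip K x (P y)) \<and>
     (\<forall>a. \<forall>x\<in>carrier K. P (\<rho> a x) = \<rho> a (P x))"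

text \<open>Orthogonality of completely positive maps. The dilation space \<open>K\<close> ranges over all Hilbert spaces
  with points in \<^typ>\<open>'a \<times> 'h \<Rightarrow> complex\<close>. This loses no generality: by minimality
  \<open>k \<mapsto> (\<lambda>(a, h). \<langle>k, \<rho>(a)Vh\<rangle>)\<close> is injective on every minimal dilation space, whose structure can
  thus be transported to this type. Since minimal dilations are unique up to unitary equivalence, it
  does not matter which one is used.\<close>

definition cp_orthogonal :: "('a::unital_cstar_algebra \<Rightarrow> 'h::complex_hilbert \<Rightarrow> 'h) \<Rightarrow>
    ('a \<Rightarrow> 'h \<Rightarrow> 'h) \<Rightarrow> bool" where
  "cp_orthogonal \<phi>1 \<phi>2 \<longleftrightarrow>
     completely_positive \<phi>1 \<and> completely_positive \<phi>2 \<and>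
     (\<exists>(K :: ('a \<times> 'h \<Rightarrow> complex) hilbert_space) V W \<rho> P.
        minimal_stinespring K V W \<rho> (\<lambda>a h. \<phi>1 a h + \<phi>2 a h) \<and>
        projection_in_commutant K \<rho> P \<and>
        (\<forall>a h. \<phi>1 a h = W (P (\<rho> a (V h)))) \<and>
        (\<forall>a h. \<phi>2 a h = W (\<rho> a (V h) \<ominus>\<^bsub>K\<^esub> P (\<rho> a (V h)))))"

text \<open>\<open>\<psi> = \<integral>\<^bsub>E\<^esub> \<phi>' d\<mu>\<close> as a weak integral.\<close>

definition has_weak_integral :: "('a::unital_cstar_algebra \<Rightarrow> 'h::complex_hilbert \<Rightarrow> 'h) measure \<Rightarrow>
    ('a \<Rightarrow> 'h \<Rightarrow> 'h) set \<Rightarrow> ('a \<Rightarrow> 'h \<Rightarrow> 'h) \<Rightarrow> bool" where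
  "has_weak_integral \<mu> E \<psi> \<longleftrightarrow>
     (\<forall>a. bounded_clinear (\<psi> a)) \<and>
     (\<forall>a h1 h2. cinner (\<psi> a h1) h2 = (LINT \<phi>':E|\<mu>. cinner (\<phi>' a h1) h2))"

definition orthogonal_measures :: "('a::unital_cstar_algebra \<Rightarrow> 'h::complex_hilbert \<Rightarrow> 'h) \<Rightarrow>
    ('a \<Rightarrow> 'h \<Rightarrow> 'h) measure set" where
  "orthogonal_measures \<phi> = {\<mu> \<in> measures_with_barycenter \<phi>.
     \<forall>E\<in>sets \<mu>. \<exists>\<psi>1 \<psi>2. has_weak_integral \<mu> E \<psi>1 \<and> has_weak_integral \<mu> (UCP - E) \<psi>2 \<and>
       cp_orthogonal \<psi>1 \<psi>2}"

end

theory Submission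
  imports Defs
begin

text \<open>The coefficients \<open>\<phi> \<mapsto> \<langle>\<phi>(a)h,k\<rangle>\<close> with \<open>a, h, k\<close> in countable dense sets are affine and separate
  points, so they embed \<^const>\<open>UCP\<close> as a compact convex subset \<open>K\<close> of the Hilbert cube. Hence almost
  every point lies in the support of \<open>\<mu>\<close>, and the equivalence follows by testing the integral identity
  with \<open>f = cnj (\<langle>\<phi>'(\<tau>\<^sub>g a)h\<^sub>1,h\<^sub>2\<rangle> - \<langle>\<phi>'(a)h\<^sub>1,h\<^sub>2\<rangle>)\<close>.

  A maximal measure is carried by the extreme points of \<open>K\<close>: let \<open>E(x) = \<Sum>\<^sub>n 2\<^sup>-\<^sup>n x\<^sub>n\<^sup>2\<close>, which is strictly
  convex, and write each \<open>x \<in> K\<close> as the midpoint of the unique pair \<open>(S x, T x)\<close> in \<open>K\<close> maximizing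
  \<open>y\<^sub>n - E(y) - E(z)\<close>. By uniqueness \<open>S\<close> and \<open>T\<close> are Borel, and the average of the images of \<open>\<mu>\<close> under
  \<open>S\<close> and \<open>T\<close> dominates \<open>\<mu>\<close>, so it equals \<open>\<mu>\<close>. Comparing the integrals of \<open>E\<close> gives \<open>S x = T x = x\<close> almost
  everywhere, for all \<open>n\<close>; at such an \<open>x\<close> no segment in \<open>K\<close> with midpoint \<open>x\<close> can move in the \<open>n\<close>-th
  coordinate, because \<open>E\<close> only contributes to second order.\<close>

section \<open>Positive functionals on C*-algebras\<close>

lemma scaleC_scaleR: "r *\<^sub>R x = complex_of_real r *\<^sub>C (x::'a::complex_banach)"
  by (simp add: scaleC_of_real)

lemma scaleC_minus_one [simp]: "(-1) *\<^sub>C (x::'a::complex_banach) = - x"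
  using scaleC_of_real[of "-1" x] by simp

text \<open>The C*-identity and submultiplicativity give
  \<open>norm y * norm y \<le> norm (star y) * norm y\<close>. Dividing, and then exchanging
  \<open>y\<close> with \<open>star y\<close>, yields both inequalities.\<close>

lemma norm_star: "norm (star x) = norm (x::'a::unital_cstar_algebra)"
proof -
  have le: "norm y \<le> norm (star y)" for y :: 'a
  proof (cases "y = 0")
    case False
    have "norm y * norm y \<le> norm (star y) * norm y"
      using norm_mult_ineq[of "star y" y] by (simp add: cstar_identity power2_eq_square)
    then show ?thesis using False by simp
  qed simp
  from le[of x] le[of "star x"] show ?thesis by (simp add: star_star)
qed

lemma star_scaleR: "star (r *\<^sub>R x) = r *\<^sub>R star (x::'a::unital_cstar_algebra)"
  by (simp add: scaleC_scaleR star_scaleC)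

lemma bounded_linear_star: "bounded_linear (star :: 'a::unital_cstar_algebra \<Rightarrow> 'a)"
  by (rule bounded_linear_intro[where K = 1]) (simp_all add: star_add star_scaleR norm_star)

lemma star_one: "star 1 = (1::'a::unital_cstar_algebra)"
proof -
  have "star (star 1 * (1::'a)) = star 1 * star (star 1)" by (simp only: star_mult)
  then show ?thesis by (simp add: star_star)
qed

lemma star_power: "star (x ^ n) = star x ^ n" for x :: "'a::unital_cstar_algebra"
  by (induction n) (simp_all add: star_one star_mult power_commutes)

text \<open>The factor absorbs the exponent 0, where \<open>norm 1\<close> has no prescribed value:
  it is 0 in the zero algebra.\<close>

lemma norm_power_le:
  "norm (x ^ n) \<le> (1 + norm (1::'a)) * norm x ^ n" for x :: "'a::unital_cstar_algebra"
proof (induction n)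
  case (Suc n)
  have "norm (x ^ Suc n) \<le> norm x * norm (x ^ n)" by (simp add: norm_mult_ineq)
  also have "\<dots> \<le> norm x * ((1 + norm (1::'a)) * norm x ^ n)"
    by (intro mult_left_mono Suc.IH) simp
  finally show ?case by (simp add: mult_ac)
qed simp

text \<open>Consecutive coefficients have ratio \<open>(1/2 - n) / (n + 1)\<close>, of absolute
  value at most 1. Bounded coefficients make the binomial series converge absolutely on the open
  unit ball.\<close>

lemma abs_half_gchoose_le_1: "\<bar>(1/2::real) gchoose n\<bar> \<le> 1"
proof (induction n)
  case (Suc n)
  have eq: "real (Suc n) * ((1/2) gchoose Suc n) = (1/2 - real n) * ((1/2) gchoose n)"
    using gbinomial_mult_1[of "1/2::real" n] by (simp add: algebra_simps)
  have "real (Suc n) * \<bar>(1/2) gchoose Suc n\<bar> = \<bar>1/2 - real n\<bar> * \<bar>(1/2) gchoose n\<bar>"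
    using arg_cong[OF eq, of abs] by (simp add: abs_mult del: of_nat_Suc)
  also have "\<dots> \<le> real (Suc n) * 1"
    by (intro mult_mono Suc.IH) auto
  finally show ?case by (simp del: of_nat_Suc)
qed simp

text \<open>The square root is the binomial series for \<open>(1 + x)\<^bsup>1/2\<^esup>\<close>.\<close>

lemma one_plus_selfadjoint_eq_star_mult:
  fixes x :: "'a::unital_cstar_algebra"
  assumes "star x = x" and "norm x < 1"
  shows "\<exists>y. 1 + x = star y * y"
proof -
  define c where "c n = ((1/2::real) gchoose n)" for n
  define a where "a n = c n *\<^sub>R x ^ n" for n
  have "norm (a n) \<le> (1 + norm (1::'a)) * norm x ^ n" for n
  proof -
    have "norm (a n) \<le> 1 * norm (x ^ n)"
      unfolding a_def norm_scaleR c_def by (intro mult_right_mono abs_half_gchoose_le_1) simp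
    also have "\<dots> \<le> (1 + norm (1::'a)) * norm x ^ n" using norm_power_le[of x n] by simp
    finally show ?thesis .
  qed
  moreover have "summable (\<lambda>n. (1 + norm (1::'a)) * norm x ^ n)"
    using assms(2) by (intro summable_mult summable_geometric) simp
  ultimately have sn: "summable (\<lambda>n. norm (a n))"
    by (intro summable_comparison_test'[of "\<lambda>n. (1 + norm (1::'a)) * norm x ^ n" 0 "\<lambda>n. norm (a n)"]) simp_all
  define y where "y = suminf a"
  have "star (a n) = a n" for n
    by (simp add: a_def star_scaleR star_power assms)
  then have star_y: "star y = y"
    unfolding y_def using bounded_linear.suminf[OF bounded_linear_star summable_norm_cancel[OF sn]]
    by simp
  \<comment> \<open>By Vandermonde, the Cauchy product of the series for exponent 1/2 with itself
    has the coefficients for exponent 1.\<close>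
  have "(\<Sum>i\<le>k. a i * a (k - i)) = (1 gchoose k) *\<^sub>R x ^ k" for k
  proof -
    have "(\<Sum>i\<le>k. a i * a (k - i)) = (\<Sum>i\<le>k. (c i * c (k - i)) *\<^sub>R x ^ k)"
      by (intro sum.cong refl) (simp add: a_def flip: power_add)
    also have "\<dots> = (1 gchoose k) *\<^sub>R x ^ k"
      using gbinomial_Vandermonde[of "1/2::real" "1/2" k]
      by (simp add: c_def flip: scaleR_left.sum atLeast0AtMost)
    finally show ?thesis .
  qed
  then have "(\<lambda>k. (1 gchoose k) *\<^sub>R x ^ k) sums (y * y)"
    using Cauchy_product_sums[OF sn sn] by (simp add: y_def)
  \<comment> \<open>For exponent 1 the series stops after \<open>1 + x\<close>.\<close>
  moreover have "(\<lambda>k. (1 gchoose k) *\<^sub>R x ^ k) sums (\<Sum>k\<in>{0,1}. (1 gchoose k) *\<^sub>R x ^ k)"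
  proof (rule sums_finite)
    fix k :: nat assume "k \<notin> {0,1}"
    then have "(1 choose k) = 0" by (intro binomial_eq_0) auto
    then have "((1::real) gchoose k) = 0" by (metis binomial_gbinomial of_nat_0 of_nat_1)
    then show "(1 gchoose k) *\<^sub>R x ^ k = 0" by simp
  qed simp
  ultimately have "y * y = 1 + x" by (simp add: sums_iff)
  then show ?thesis using star_y by metis
qed

section \<open>Inner products and dense sets\<close>

lemma cinner_add_right: "cinner x (y + z) = cinner x y + cinner x (z::'a::complex_hilbert)"
  by (subst (1 2 3) cinner_commute) (simp add: cinner_add_left)

lemma cinner_scaleC_right: "cinner x (c *\<^sub>C y) = cnj c * cinner x (y::'a::complex_hilbert)"
  by (subst (1 2) cinner_commute) (simp add: cinner_scaleC_left)

lemma cinner_scaleR_left: "cinner (r *\<^sub>R x) y = of_real r * cinner x (y::'a::complex_hilbert)"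
  by (simp add: scaleC_scaleR cinner_scaleC_left)

lemma cinner_scaleR_right: "cinner x (r *\<^sub>R y) = of_real r * cinner x (y::'a::complex_hilbert)"
  by (simp add: scaleC_scaleR cinner_scaleC_right)

lemma cinner_minus_left: "cinner (- x) y = - cinner x (y::'a::complex_hilbert)"
  using cinner_scaleR_left[of "-1" x y] by simp

lemma cinner_minus_right: "cinner x (- y) = - cinner x (y::'a::complex_hilbert)"
  using cinner_scaleR_right[of x "-1" y] by simp

lemma cinner_diff_left: "cinner (x - y) z = cinner x z - cinner y (z::'a::complex_hilbert)"
  using cinner_add_left[of x "- y" z] by (simp add: cinner_minus_left)

lemma cinner_diff_right: "cinner x (y - z) = cinner x y - cinner x (z::'a::complex_hilbert)"
  using cinner_add_right[of x y "- z"] by (simp add: cinner_minus_right)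

lemma cinner_zero_left [simp]: "cinner 0 (x::'a::complex_hilbert) = 0"
  using cinner_scaleR_left[of 0 0 x] by simp

lemma cinner_zero_right [simp]: "cinner (x::'a::complex_hilbert) 0 = 0"
  using cinner_scaleR_right[of x 0 0] by simp

lemma norm_diff_squared:
  "(norm (x - y))\<^sup>2 = (norm x)\<^sup>2 - 2 * Re (cinner x y) + (norm (y::'a::complex_hilbert))\<^sup>2"
proof -
  have "complex_of_real ((norm (x - y))\<^sup>2) = cinner (x - y) (x - y)" by (simp only: cinner_self)
  also have "\<dots> = cinner x x - cinner x y - cnj (cinner x y) + cinner y y"
    using cinner_commute[of y x] by (simp add: cinner_diff_left cinner_diff_right)
  finally have "(norm (x - y))\<^sup>2 = Re (cinner x x - cinner x y - cnj (cinner x y) + cinner y y)"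
    by (metis Re_complex_of_real)
  then show ?thesis by (simp add: cinner_self)
qed

lemma norm_add_squared:
  "(norm (x + y))\<^sup>2 = (norm x)\<^sup>2 + 2 * Re (cinner x y) + (norm (y::'a::complex_hilbert))\<^sup>2"
  using norm_diff_squared[of x "- y"] by (simp add: cinner_minus_right)

text \<open>Some \<open>k\<close> in \<open>D\<close> is closer to a nonzero \<open>v\<close> than
  \<open>norm v\<close>, but a vanishing real part gives \<open>norm (v - k) \<ge> norm v\<close>.
  Real parts suffice, so real coordinates will separate UCP maps.\<close>

lemma cinner_eq_zero_if_dense:
  fixes v :: "'a::complex_hilbert"
  assumes "closure D = UNIV" and "\<And>k. k \<in> D \<Longrightarrow> Re (cinner v k) = 0"
  shows "v = 0"
proof (rule ccontr)
  assume "v \<noteq> 0"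
  have "v \<in> closure D" using assms by simp
  then obtain k where k: "k \<in> D" "dist k v < norm v"
    using \<open>v \<noteq> 0\<close> by (metis closure_approachable zero_less_norm_iff)
  have "(norm (v - k))\<^sup>2 \<ge> (norm v)\<^sup>2"
    unfolding norm_diff_squared using assms(2)[OF k(1)] by simp
  then have "norm v \<le> norm (v - k)" by (rule power2_le_imp_le) simp
  then show False using k(2) by (simp add: dist_norm norm_minus_commute)
qed

section \<open>Bounds for the matrix coefficients of UCP maps\<close>

lemma completely_positive_nonneg:
  assumes "completely_positive \<phi>"
  shows "cinner (\<phi> (star y * y) h) h \<in> \<real>\<^sub>\<ge>\<^sub>0"
proof -
  have "positive_matrix 1 (\<lambda>_ _. star y * y)"
    unfolding positive_matrix_def by (rule exI[of _ "\<lambda>_ _. y"]) simp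
  then have "positive_operator_matrix 1 (\<lambda>_ _. \<phi> (star y * y))"
    using assms unfolding completely_positive_def by blast
  then show ?thesis unfolding positive_operator_matrix_def by (auto dest: spec[of _ "\<lambda>_. h"])
qed

lemma UCP_D:
  assumes "\<phi> \<in> UCP"
  shows UCP_clinear: "\<phi> a (h + k) = \<phi> a h + \<phi> a k" "\<phi> a (c *\<^sub>C h) = c *\<^sub>C \<phi> a h"
    and UCP_add: "\<phi> (a + b) h = \<phi> a h + \<phi> b h"
    and UCP_scaleC: "\<phi> (c *\<^sub>C a) h = c *\<^sub>C \<phi> a h"
    and UCP_one: "\<phi> 1 h = h"
    and UCP_nonneg: "cinner (\<phi> (star y * y) h) h \<in> \<real>\<^sub>\<ge>\<^sub>0"
  using assms completely_positive_nonneg[of \<phi> y h]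
  by (auto simp: UCP_def completely_positive_def bounded_clinear_def clinear_def)

lemma UCP_scaleR: "\<phi> \<in> UCP \<Longrightarrow> \<phi> (r *\<^sub>R a) h = r *\<^sub>R \<phi> a h"
  by (simp add: scaleC_scaleR UCP_scaleC)

lemma UCP_diff:
  assumes "\<phi> \<in> UCP"
  shows "\<phi> (a - b) h = \<phi> a h - \<phi> b h" and "\<phi> a (h - k) = \<phi> a h - \<phi> a k"
proof -
  have "\<phi> (a - b + b) h = \<phi> (a - b) h + \<phi> b h" by (rule UCP_add[OF assms])
  then show "\<phi> (a - b) h = \<phi> a h - \<phi> b h" by simp
  have "\<phi> a (h - k + k) = \<phi> a (h - k) + \<phi> a k" by (rule UCP_clinear[OF assms])
  then show "\<phi> a (h - k) = \<phi> a h - \<phi> a k" by simp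
qed

text \<open>After rescaling \<open>x\<close> to \<open>u\<close> of norm 1/2, both
  \<open>1 + u\<close> and \<open>1 - u\<close> have the form \<open>star y * y\<close>. Positivity
  then makes \<open>cinner (\<phi> u h) h\<close> real and confines it between
  \<open>- (norm h)\<^sup>2\<close> and \<open>(norm h)\<^sup>2\<close>.\<close>

lemma UCP_quadratic_bound_selfadjoint:
  assumes "\<phi> \<in> UCP" "star x = x"
  shows "cmod (cinner (\<phi> x h) h) \<le> 2 * norm x * (norm h)\<^sup>2"
proof (cases "x = 0")
  case True
  have "\<phi> 0 h = 0" using UCP_diff(1)[OF assms(1), of 0 0 h] by simp
  then show ?thesis using True by simp
next
  case False
  \<comment> \<open>The factor 2 puts \<open>u\<close> strictly inside the unit ball, where the
    binomial square root exists; it reappears in the bound.\<close>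
  define t where "t = 2 * norm x"
  have t: "t > 0" using False by (simp add: t_def)
  define u where "u = (1/t) *\<^sub>R x"
  have u: "star u = u" "norm u < 1" "star (- u) = - u" "norm (- u) < 1"
    using t assms(2) star_scaleR[of "-1/t" x] by (simp_all add: u_def star_scaleR t_def)
  obtain y z where yz: "1 + u = star y * y" "1 + - u = star z * z"
    using one_plus_selfadjoint_eq_star_mult u by metis
  define s where "s = cinner (\<phi> u h) h"
  have "cinner (\<phi> (1 + u) h) h \<in> \<real>\<^sub>\<ge>\<^sub>0" "cinner (\<phi> (1 - u) h) h \<in> \<real>\<^sub>\<ge>\<^sub>0"
    using UCP_nonneg[OF assms(1), of y h] UCP_nonneg[OF assms(1), of z h] yz by simp_all
  then have "(norm h)\<^sup>2 + s \<in> \<real>\<^sub>\<ge>\<^sub>0" "(norm h)\<^sup>2 - s \<in> \<real>\<^sub>\<ge>\<^sub>0"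
    by (simp_all add: UCP_add[OF assms(1)] UCP_diff[OF assms(1)] UCP_one[OF assms(1)]
        cinner_add_left cinner_diff_left cinner_self s_def)
  then have s: "Im s = 0" "\<bar>Re s\<bar> \<le> (norm h)\<^sup>2"
    by (auto simp: complex_nonneg_Reals_iff)
  then have "cmod s \<le> (norm h)\<^sup>2" using cmod_eq_Re[of s] by simp
  moreover have "cinner (\<phi> x h) h = t * s"
    using t by (simp add: s_def u_def UCP_scaleR[OF assms(1)] cinner_scaleR_left)
  ultimately show ?thesis using t by (simp add: norm_mult t_def mult_left_mono)
qed

text \<open>Write \<open>a\<close> as \<open>p\<close> plus \<open>\<i>\<close> times
  \<open>q\<close> with \<open>p\<close>, \<open>q\<close> selfadjoint of norm at most
  \<open>norm a\<close>; the two selfadjoint bounds add up.\<close>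

lemma UCP_quadratic_bound:
  assumes "\<phi> \<in> UCP"
  shows "cmod (cinner (\<phi> a h) h) \<le> 4 * norm a * (norm h)\<^sup>2"
proof -
  define p where "p = (1/2) *\<^sub>R (a + star a)"
  define q where "q = (- \<i> / 2) *\<^sub>C (a - star a)"
  have star_diff: "star (a - star a) = star a - a"
    using bounded_linear_sub[OF bounded_linear_star] linear_diff[OF bounded_linear.linear[OF bounded_linear_star], of a "star a"]
    by (simp add: star_star)
  have "star p = p" by (simp add: p_def star_scaleR star_add star_star add.commute)
  moreover have "star q = q"
  proof -
    have "star q = (\<i> / 2) *\<^sub>C ((-1) *\<^sub>C (a - star a))" by (simp add: q_def star_scaleC star_diff)
    then show ?thesis by (simp only: scaleC_scaleC q_def) simp
  qed
  moreover have "norm p \<le> norm a" "norm q \<le> norm a"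
    using norm_triangle_ineq[of a "star a"] norm_triangle_ineq4[of a "star a"]
    by (simp_all add: p_def q_def norm_star norm_scaleC norm_mult norm_divide)
  ultimately have b: "cmod (cinner (\<phi> p h) h) \<le> 2 * norm a * (norm h)\<^sup>2"
    "cmod (cinner (\<phi> q h) h) \<le> 2 * norm a * (norm h)\<^sup>2"
    using UCP_quadratic_bound_selfadjoint[OF assms, of p h]
      UCP_quadratic_bound_selfadjoint[OF assms, of q h]
    by (smt (verit) mult_right_mono zero_le_power2)+
  have "\<i> *\<^sub>C q = (1/2) *\<^sub>R (a - star a)"
    by (simp add: q_def scaleC_scaleC scaleC_scaleR)
  then have "p + \<i> *\<^sub>C q = (1/2) *\<^sub>R (a + a)" by (simp add: p_def flip: scaleR_add_right)
  then have "a = p + \<i> *\<^sub>C q" by (simp flip: scaleR_2)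
  then have "cinner (\<phi> a h) h = cinner (\<phi> p h) h + \<i> * cinner (\<phi> q h) h"
    by (simp add: UCP_add[OF assms] UCP_scaleC[OF assms] cinner_add_left cinner_scaleC_left)
  then show ?thesis using b norm_triangle_ineq[of "cinner (\<phi> p h) h" "\<i> * cinner (\<phi> q h) h"]
    by (simp add: norm_mult)
qed

text \<open>Polarization over the four values \<open>1\<close>, \<open>\<i>\<close>,
  \<open>-1\<close>, \<open>-\<i>\<close> of \<open>c\<close> bounds the coefficient by a multiple
  of \<open>(norm h + norm k)\<^sup>2\<close>. Applied to unit vectors, where this square is 4, and
  rescaled, it gives the product form with constant 16.\<close>

lemma UCP_bound:
  assumes "\<phi> \<in> UCP"
  shows "cmod (cinner (\<phi> a h) k) \<le> 16 * norm a * norm h * norm k"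
proof -
  have polar: "cmod (cinner (\<phi> a h) k) \<le> 4 * norm a * (norm h + norm k)\<^sup>2" for h k
  proof -
    define B where "B c = cinner (\<phi> a (h + c *\<^sub>C k)) (h + c *\<^sub>C k)" for c
    have B: "B c = cinner (\<phi> a h) h + c * cinner (\<phi> a k) h + cnj c * cinner (\<phi> a h) k
      + c * cnj c * cinner (\<phi> a k) k" for c
      by (simp add: B_def UCP_clinear[OF assms] cinner_add_left cinner_add_right
          cinner_scaleC_left cinner_scaleC_right algebra_simps)
    have "cmod (B c) \<le> 4 * norm a * (norm h + norm k)\<^sup>2" if "cmod c = 1" for c
    proof -
      have "cmod (B c) \<le> 4 * norm a * (norm (h + c *\<^sub>C k))\<^sup>2"
        unfolding B_def by (rule UCP_quadratic_bound[OF assms])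
      also have "norm (h + c *\<^sub>C k) \<le> norm h + norm k"
        using norm_triangle_ineq[of h "c *\<^sub>C k"] that by (simp add: norm_scaleC)
      then have "4 * norm a * (norm (h + c *\<^sub>C k))\<^sup>2 \<le> 4 * norm a * (norm h + norm k)\<^sup>2"
        by (intro mult_left_mono power_mono) auto
      finally show ?thesis .
    qed
    then have "cmod (B 1) \<le> 4 * norm a * (norm h + norm k)\<^sup>2"
      "cmod (\<i> * B \<i>) \<le> 4 * norm a * (norm h + norm k)\<^sup>2"
      "cmod (- B (-1)) \<le> 4 * norm a * (norm h + norm k)\<^sup>2"
      "cmod (- \<i> * B (-\<i>)) \<le> 4 * norm a * (norm h + norm k)\<^sup>2"
      by (simp_all add: norm_mult)
    moreover have "4 * cinner (\<phi> a h) k = (B 1 + \<i> * B \<i>) + (- B (-1) + - \<i> * B (-\<i>))"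
      by (simp add: B algebra_simps)
    then have "4 * cmod (cinner (\<phi> a h) k) = cmod ((B 1 + \<i> * B \<i>) + (- B (-1) + - \<i> * B (-\<i>)))"
      by (metis norm_mult norm_numeral)
    ultimately show ?thesis
      using norm_triangle_ineq[of "B 1 + \<i> * B \<i>" "- B (-1) + - \<i> * B (-\<i>)"]
        norm_triangle_ineq[of "B 1" "\<i> * B \<i>"] norm_triangle_ineq[of "- B (-1)" "- \<i> * B (-\<i>)"]
      by linarith
  qed
  show ?thesis
  proof (cases "h = 0 \<or> k = 0")
    case True
    have "\<phi> a 0 = 0" using UCP_diff(2)[OF assms, of a 0 0] by simp
    then show ?thesis using True by auto
  next
    case False
    define h' where "h' = complex_of_real (1 / norm h) *\<^sub>C h"
    define k' where "k' = complex_of_real (1 / norm k) *\<^sub>C k"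
    have "norm h' = 1" "norm k' = 1" using False by (simp_all add: h'_def k'_def norm_scaleC norm_divide)
    then have "cmod (cinner (\<phi> a h') k') \<le> 16 * norm a" using polar[of h' k'] by simp
    moreover have "cmod (cinner (\<phi> a h') k') = cmod (cinner (\<phi> a h) k) / (norm h * norm k)"
      by (simp add: h'_def k'_def UCP_clinear[OF assms] cinner_scaleC_left cinner_scaleC_right
          norm_mult norm_divide)
    ultimately show ?thesis using False by (simp add: field_simps)
  qed
qed

section \<open>The Riesz representation theorem\<close>

text \<open>The representing vector minimizes \<open>x \<mapsto> \<parallel>x\<parallel>\<^sup>2 - 2 Re f(x)\<close>.\<close>

lemma riesz_representation:
  fixes f :: "'h::complex_hilbert \<Rightarrow> complex"
  assumes add: "\<And>x y. f (x + y) = f x + f y" and scale: "\<And>c x. f (c *\<^sub>C x) = cnj c * f x"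
    and bound: "\<And>x. cmod (f x) \<le> C * norm x"
  shows "\<exists>v. \<forall>k. f k = cinner v k"
proof -
  define g where "g x = (norm x)\<^sup>2 - 2 * Re (f x)" for x
  have scaleR: "f (r *\<^sub>R x) = of_real r * f x" for r x by (simp add: scaleC_scaleR scale)
  have fdiff: "f (x - y) = f x - f y" for x y using add[of "x - y" y] by simp
  \<comment> \<open>Completing the square in \<open>norm x\<close> bounds \<open>g\<close> below, so
    the infimum \<open>m\<close> is meaningful.\<close>
  have g_lower: "g x \<ge> - C\<^sup>2" for x
  proof -
    have "Re (f x) \<le> C * norm x" using bound[of x] complex_Re_le_cmod[of "f x"] by linarith
    moreover have "(norm x - C)\<^sup>2 \<ge> 0" by simp
    ultimately show ?thesis by (simp add: g_def power2_diff algebra_simps)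
  qed
  define m where "m = Inf (range g)"
  have bdd: "bdd_below (range g)" using g_lower by (intro bdd_belowI2[of _ "- C\<^sup>2"]) auto
  have m_le: "m \<le> g x" for x unfolding m_def by (rule cInf_lower[OF _ bdd]) simp
  have "\<exists>x. g x < m + inverse (real (Suc n))" for n
    using cInf_lessD[of "range g" "m + inverse (real (Suc n))"] by (auto simp: m_def)
  then obtain x where x: "\<And>n. g (x n) < m + inverse (real (Suc n))" by metis
  \<comment> \<open>The terms of \<open>f\<close> cancel by additivity, so the parallelogram law
    passes from the squared norm to \<open>g\<close> and forces near-minimizers to be close
    together.\<close>
  have parallelogram: "(norm (y - z))\<^sup>2 = 2 * g y + 2 * g z - 4 * g ((1/2) *\<^sub>R (y + z))" for y z
    using norm_diff_squared[of y z] norm_add_squared[of y z]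
    by (simp add: g_def scaleR add power_divide) (simp add: field_simps)
  have "Cauchy x"
  proof (rule metric_CauchyI)
    fix e :: real assume "e > 0"
    \<comment> \<open>Two values of \<open>g\<close> within \<open>e\<^sup>2 / 4\<close> of the
      infimum leave less than \<open>e\<^sup>2\<close> in the parallelogram identity.\<close>
    then obtain N where N: "inverse (real (Suc N)) < e\<^sup>2 / 4"
      using reals_Archimedean[of "e\<^sup>2 / 4"] by auto
    show "\<exists>M. \<forall>m\<ge>M. \<forall>n\<ge>M. dist (x m) (x n) < e"
    proof (intro exI allI impI)
      fix i j assume "N \<le> i" "N \<le> j"
      then have "inverse (real (Suc i)) \<le> inverse (real (Suc N))"
        "inverse (real (Suc j)) \<le> inverse (real (Suc N))" by simp_all
      then have "(norm (x i - x j))\<^sup>2 < e\<^sup>2"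
        using parallelogram[of "x i" "x j"] x[of i] x[of j] m_le[of "(1/2) *\<^sub>R (x i + x j)"] N by linarith
      then show "dist (x i) (x j) < e"
        using \<open>e > 0\<close> by (simp add: dist_norm power_less_imp_less_base)
    qed
  qed
  then obtain v where v: "x \<longlonglongrightarrow> v" using Cauchy_convergent_iff convergent_def by blast
  have "(\<lambda>n. f (x n)) \<longlonglongrightarrow> f v"
  proof (rule metric_tendsto_imp_tendsto)
    show "(\<lambda>n. C * norm (x n - v)) \<longlonglongrightarrow> 0"
      by (rule tendsto_eq_intros refl tendsto_norm_zero LIM_zero v)+ simp
    show "\<forall>\<^sub>F n in sequentially. dist (f (x n)) (f v) \<le> dist (C * norm (x n - v)) 0"
      using bound[of "x _ - v"] by (auto simp: dist_norm fdiff intro!: always_eventually order_trans[OF bound[of "x _ - v", unfolded fdiff]])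
  qed
  then have "(\<lambda>n. g (x n)) \<longlonglongrightarrow> g v"
    unfolding g_def by (intro tendsto_intros v)
  moreover have "(\<lambda>n. m + inverse (real (Suc n))) \<longlonglongrightarrow> m + 0"
    by (intro tendsto_intros LIMSEQ_inverse_real_of_nat)
  ultimately have "g v \<le> m"
    using x by (intro LIMSEQ_le[of "\<lambda>n. g (x n)" _ "\<lambda>n. m + inverse (real (Suc n))"]) (auto intro: less_imp_le)
  then have gv: "g v \<le> g y" for y using m_le[of y] by simp
  have re: "Re (f k) = Re (cinner v k)" for k
  proof -
    define d where "d = Re (cinner v k) - Re (f k)"
    \<comment> \<open>Comparing the minimizer \<open>v\<close> with \<open>v + t *\<^sub>R k\<close>
      gives a quadratic in \<open>t\<close> without constant term that is never negative, so its
      linear coefficient \<open>2 * d\<close> must vanish.\<close>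
    have q: "0 \<le> t\<^sup>2 * (norm k)\<^sup>2 + 2 * t * d" for t
      using gv[of "v + t *\<^sub>R k"] norm_add_squared[of v "t *\<^sub>R k"]
      by (simp add: g_def add scaleR d_def power_mult_distrib cinner_scaleR_right algebra_simps)
    \<comment> \<open>Inserting \<open>t = - d / r\<close> with \<open>r > (norm k)\<^sup>2\<close>
      rules out \<open>d \<noteq> 0\<close>; the added 1 keeps \<open>r\<close> positive when
      \<open>k = 0\<close>.\<close>
    define r where "r = 1 + (norm k)\<^sup>2"
    have r: "r > 0" "(norm k)\<^sup>2 < r" using zero_le_power2[of "norm k"] by (simp_all add: r_def add_pos_nonneg)
    have "0 \<le> r\<^sup>2 * ((- d / r)\<^sup>2 * (norm k)\<^sup>2 + 2 * (- d / r) * d)" by (intro mult_nonneg_nonneg q) simp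
    also have "\<dots> = d\<^sup>2 * (norm k)\<^sup>2 - 2 * r * d\<^sup>2"
      using r by (simp add: field_simps power2_eq_square)
    finally have "d\<^sup>2 * (2 * r - (norm k)\<^sup>2) \<le> 0" by (simp add: algebra_simps)
    then have "d = 0" using r by (smt (verit) mult_pos_pos zero_less_power2)
    then show ?thesis by (simp add: d_def)
  qed
  \<comment> \<open>Both sides are conjugate-linear in \<open>k\<close>, so the real part at
    \<open>\<i> *\<^sub>C k\<close> is the imaginary part at \<open>k\<close>.\<close>
  have "Im (f k) = Im (cinner v k)" for k
    using re[of "\<i> *\<^sub>C k"] by (simp add: scale cinner_scaleC_right)
  then show ?thesis using re by (auto intro: complex_eqI)
qed

section \<open>Compactness and metrizability of the BW topology\<close>

definition matrix_coefficients ::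
    "('a \<Rightarrow> 'h::complex_hilbert \<Rightarrow> 'h) \<Rightarrow> 'a \<times> 'h \<times> 'h \<Rightarrow> complex" where
  "matrix_coefficients \<phi> = (\<lambda>(a, h, k). cinner (\<phi> a h) k)"

lemma BW_alt: "BW = pullback_topology UCP matrix_coefficients euclidean"
  unfolding BW_def euclidean_product_topology matrix_coefficients_def ..

lemma cinner_eq_imp_eq:
  assumes "\<And>k. cinner v k = cinner w (k::'h::complex_hilbert)"
  shows "v = w"
  using cinner_eq_zero_if_dense[of UNIV "v - w"] assms by (simp add: cinner_diff_left)

lemma inj_on_matrix_coefficients: "inj_on matrix_coefficients UCP"
proof (rule inj_onI)
  fix \<phi> \<psi> :: "'a \<Rightarrow> 'b \<Rightarrow> 'b"
  assume "matrix_coefficients \<phi> = matrix_coefficients \<psi>"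
  then have "cinner (\<phi> a h) k = cinner (\<psi> a h) k" for a h k
    by (auto simp: matrix_coefficients_def dest: fun_cong[of _ _ "(a, h, k)"])
  then show "\<phi> = \<psi>" by (intro ext cinner_eq_imp_eq)
qed

lemma cinner_sum_left: "cinner (\<Sum>i\<in>I. f i) y = (\<Sum>i\<in>I. cinner (f i) (y::'h::complex_hilbert))"
  by (induction I rule: infinite_finite_induct) (simp_all add: cinner_add_left)

text \<open>Each condition on \<open>u\<close> involves only finitely many coordinates, which makes
  the image visibly closed. Conversely, for fixed \<open>a\<close> and \<open>h\<close> such a
  \<open>u\<close> is bounded and conjugate-linear in \<open>k\<close>, and its Riesz vector serves
  as \<open>\<phi> a h\<close>.\<close>

lemma matrix_coefficients_UCP:
  "matrix_coefficients ` (UCP :: ('a::unital_cstar_algebra \<Rightarrow> 'h::complex_hilbert \<Rightarrow> 'h) set) =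
    {u. (\<forall>a h k. cmod (u (a, h, k)) \<le> 16 * norm a * norm h * norm k) \<and>
        (\<forall>a b h k. u (a + b, h, k) = u (a, h, k) + u (b, h, k)) \<and>
        (\<forall>c a h k. u (c *\<^sub>C a, h, k) = c * u (a, h, k)) \<and>
        (\<forall>a h h' k. u (a, h + h', k) = u (a, h, k) + u (a, h', k)) \<and>
        (\<forall>c a h k. u (a, c *\<^sub>C h, k) = c * u (a, h, k)) \<and>
        (\<forall>a h k k'. u (a, h, k + k') = u (a, h, k) + u (a, h, k')) \<and>
        (\<forall>c a h k. u (a, h, c *\<^sub>C k) = cnj c * u (a, h, k)) \<and>
        (\<forall>h k. u (1, h, k) = cinner h k) \<and>
        (\<forall>n X h. positive_matrix n X \<longrightarrow> (\<Sum>i<n. \<Sum>j<n. u (X i j, h j, h i)) \<in> \<real>\<^sub>\<ge>\<^sub>0)}"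
  (is "?L = ?R")
proof (intro subset_antisym subsetI)
  fix u :: "'a \<times> 'h \<times> 'h \<Rightarrow> complex" assume "u \<in> ?L"
  then obtain \<phi> where \<phi>: "\<phi> \<in> UCP" and u: "u = matrix_coefficients \<phi>" by auto
  have "(\<Sum>i<n. \<Sum>j<n. u (X i j, h j, h i)) \<in> \<real>\<^sub>\<ge>\<^sub>0" if "positive_matrix n X" for n X h
  proof -
    have "positive_operator_matrix n (\<lambda>i j. \<phi> (X i j))"
      using \<phi> that unfolding UCP_def completely_positive_def by auto
    then show ?thesis
      by (auto simp: positive_operator_matrix_def cinner_sum_left u matrix_coefficients_def)
  qed
  then show "u \<in> ?R"
    using UCP_bound[OF \<phi>]
    by (auto simp: u matrix_coefficients_def UCP_add[OF \<phi>] UCP_scaleC[OF \<phi>] UCP_clinear[OF \<phi>]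
        UCP_one[OF \<phi>] cinner_add_left cinner_add_right cinner_scaleC_left cinner_scaleC_right)
next
  fix u :: "'a \<times> 'h \<times> 'h \<Rightarrow> complex" assume u: "u \<in> ?R"
  have "\<exists>v. \<forall>k. u (a, h, k) = cinner v k" for a h
    using u by (intro riesz_representation[where C = "16 * norm a * norm h"]) auto
  then obtain \<phi> where \<phi>: "\<And>a h k. u (a, h, k) = cinner (\<phi> a h) k" by metis
  have lin: "\<phi> (a + b) h = \<phi> a h + \<phi> b h" "\<phi> (c *\<^sub>C a) h = c *\<^sub>C \<phi> a h"
    "\<phi> a (h + h') = \<phi> a h + \<phi> a h'" "\<phi> a (c *\<^sub>C h) = c *\<^sub>C \<phi> a h" "\<phi> 1 h = h" for a b c h h'
    by (rule cinner_eq_imp_eq, use u in \<open>simp add: cinner_add_left cinner_scaleC_left flip: \<phi>\<close>)+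
  have "norm (\<phi> a h) \<le> 16 * norm a * norm h" for a h
  proof (cases "\<phi> a h = 0")
    case False
    have "norm (\<phi> a h) * norm (\<phi> a h) = cmod (u (a, h, \<phi> a h))"
      by (simp add: \<phi> cinner_self norm_power power2_eq_square norm_mult)
    also have "\<dots> \<le> (16 * norm a * norm h) * norm (\<phi> a h)" using u by simp
    finally show ?thesis using False by simp
  qed simp
  then have "bounded_clinear (\<phi> a)" for a
    unfolding bounded_clinear_def clinear_def using lin by blast
  moreover have "positive_operator_matrix n (\<lambda>i j. \<phi> (X i j))" if "positive_matrix n X" for n X
    using u that by (simp add: positive_operator_matrix_def cinner_sum_left flip: \<phi>)
  ultimately have "\<phi> \<in> UCP" using lin by (auto simp: UCP_def completely_positive_def)
  moreover have "u = matrix_coefficients \<phi>" by (auto simp: matrix_coefficients_def \<phi>)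
  ultimately show "u \<in> ?L" by blast
qed

text \<open>The coefficient bounds place the image in a product of discs, compact by Tychonoff, and
  the algebraic and positivity conditions are closed.\<close>

lemma compact_matrix_coefficients:
  "compact (matrix_coefficients ` (UCP :: ('a::unital_cstar_algebra \<Rightarrow> 'h::complex_hilbert \<Rightarrow> 'h) set))"
proof -
  define D where
    "D = PiE UNIV (\<lambda>(a::'a, h::'h, k::'h). cball (0::complex) (16 * norm a * norm h * norm k))"
  have "compactin (product_topology (\<lambda>_. euclidean) UNIV) D"
    unfolding D_def compactin_PiE by (auto split: prod.splits)
  then have "compact D" by (simp add: euclidean_product_topology)
  have [continuous_intros]: "continuous_on UNIV (\<lambda>u::'a \<times> 'h \<times> 'h \<Rightarrow> complex. u i)" for i by simp
  have "closed (matrix_coefficients ` (UCP :: ('a \<Rightarrow> 'h \<Rightarrow> 'h) set))"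
    unfolding matrix_coefficients_UCP
    by (intro closed_Collect_conj closed_Collect_all closed_Collect_imp closed_Collect_eq
        closed_Collect_le continuous_intros open_Collect_const
        closed_vimage[of _ "\<lambda>u. (\<Sum>i<_. \<Sum>j<_. u (_ i j, _ j, _ i))", unfolded vimage_def] closed_nonneg_Reals_complex)
  moreover have "matrix_coefficients ` (UCP :: ('a \<Rightarrow> 'h \<Rightarrow> 'h) set) \<subseteq> D"
    unfolding matrix_coefficients_UCP D_def by auto
  ultimately show ?thesis using \<open>compact D\<close> by (metis compact_Int_closed inf.absorb2)
qed

text \<open>Into a pullback topology, the inverse of the embedding is automatically continuous, so
  \<open>UCP\<close> is a continuous image of a compact set.\<close>

lemma compact_space_BW: "compact_space (BW :: ('a::unital_cstar_algebra \<Rightarrow> 'h::complex_hilbert \<Rightarrow> 'h) topology)"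
proof -
  let ?U = "UCP :: ('a \<Rightarrow> 'h \<Rightarrow> 'h) set" and ?\<Phi> = "matrix_coefficients :: ('a \<Rightarrow> 'h \<Rightarrow> 'h) \<Rightarrow> _"
  let ?Z = "?\<Phi> ` ?U" and ?\<Psi> = "inv_into ?U ?\<Phi>"
  have "continuous_map (top_of_set ?Z) euclidean id" by (simp add: continuous_on_id)
  then have "continuous_map (top_of_set ?Z) euclidean (?\<Phi> \<circ> ?\<Psi>)"
    by (rule continuous_map_eq) (simp add: f_inv_into_f)
  then have "continuous_map (top_of_set ?Z) BW ?\<Psi>"
    unfolding BW_alt by (rule continuous_map_pullback') (auto intro: inv_into_into)
  moreover have "compactin (top_of_set ?Z) ?Z"
    by (simp add: compactin_subtopology compact_matrix_coefficients)
  ultimately have "compactin BW (?\<Psi> ` ?Z)" by (rule image_compactin[rotated])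
  moreover have "?\<Psi> ` ?Z = ?U"
    by (simp add: inv_into_image_cancel[OF inj_on_matrix_coefficients])
  ultimately show ?thesis by (simp add: compact_space_def topspace_BW)
qed

lemma continuous_map_matrix_coefficient:
  "continuous_map BW euclidean (\<lambda>\<phi>. cinner (\<phi> a h) k)"
proof -
  have "continuous_map BW euclidean ((\<lambda>u. u (a, h, k)) \<circ> matrix_coefficients)"
    unfolding BW_alt by (intro continuous_map_pullback) simp
  then show ?thesis by (simp add: matrix_coefficients_def comp_def)
qed

section \<open>Countably many affine coordinates on the space of UCP maps\<close>

lemma dense_sequence:
  assumes "separable_space (euclidean :: 'a::topological_space topology)"
  shows "\<exists>d :: nat \<Rightarrow> 'a::topological_space. closure (range d) = UNIV"
proof -
  obtain U :: "'a set" where "countable U" "closure U = UNIV"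
    using assms by (auto simp: separable_space_def)
  then show ?thesis by (metis closure_empty empty_not_UNIV range_from_nat_into)
qed

text \<open>This extends equality of matrix coefficients from a dense sequence to all arguments, one
  argument at a time, with Lipschitz constants supplied by \<open>UCP_bound\<close>.\<close>

lemma lipschitz_eq_on_dense:
  fixes f g :: "'z::real_normed_vector \<Rightarrow> complex"
  assumes "\<And>n. f (d n) = g (d n)" "closure (range d) = UNIV"
    and "\<And>x y. cmod (f x - f y) \<le> C * norm (x - y)" "\<And>x y. cmod (g x - g y) \<le> C * norm (x - y)"
  shows "f = g"
proof -
  have cont: "continuous_on UNIV F" if F: "\<And>x y. cmod (F x - F y) \<le> C * norm (x - y)"
    for F :: "'z \<Rightarrow> complex"
  proof (intro continuous_at_imp_continuous_on ballI)
    fix x :: 'z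
    have "((\<lambda>y. C * norm (y - x)) \<longlongrightarrow> C * norm (x - x)) (at x)" by (intro tendsto_intros)
    then have lim: "((\<lambda>y. C * norm (y - x)) \<longlongrightarrow> 0) (at x)" by simp
    have "((\<lambda>y. F y - F x) \<longlongrightarrow> 0) (at x)"
      by (rule Lim_null_comparison[OF _ lim]) (simp add: F)
    then show "isCont F x" by (simp add: continuous_at LIM_zero_cancel)
  qed
  have "closed {x. f x = g x}" using cont[OF assms(3)] cont[OF assms(4)] by (intro closed_Collect_eq)
  moreover have "range d \<subseteq> {x. f x = g x}" using assms(1) by auto
  ultimately show "f = g" using assms(2) closure_minimal[of "range d" "{x. f x = g x}"] by auto
qed

text \<open>The coordinates are rescaled real parts of matrix coefficients at points of dense
  sequences. They separate UCP maps, and a continuous injection from a compact space into a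
  Hausdorff space is a homeomorphism onto its image.\<close>

lemma BW_coordinates:
  assumes "separable_space (euclidean :: 'a::unital_cstar_algebra topology)"
    and "separable_space (euclidean :: 'h::complex_hilbert topology)"
  obtains e :: "('a::unital_cstar_algebra \<Rightarrow> 'h::complex_hilbert \<Rightarrow> 'h) \<Rightarrow> nat \<Rightarrow> real"
  where "homeomorphic_map BW (top_of_set (e ` UCP)) e" and "inj_on e UCP"
    and "\<And>\<phi> n. \<phi> \<in> UCP \<Longrightarrow> \<bar>e \<phi> n\<bar> \<le> 1"
    and "\<And>t \<phi> \<psi> n. e (convex_comb t \<phi> \<psi>) n = t * e \<phi> n + (1 - t) * e \<psi> n"
proof -
  obtain da :: "nat \<Rightarrow> 'a" where da: "closure (range da) = UNIV" using dense_sequence assms(1) by blast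
  obtain dh :: "nat \<Rightarrow> 'h" where dh: "closure (range dh) = UNIV" using dense_sequence assms(2) by blast
  \<comment> \<open>The scale comes from \<open>UCP_bound\<close> and puts all coordinates between
    -1 and 1; the summand 1 avoids a zero denominator.\<close>
  define c where "c a h k = 1 / (1 + 16 * norm a * norm h * norm k)" for a :: 'a and h k :: 'h
  define e where "e \<phi> n = (case from_nat n of (i, j, l) \<Rightarrow>
      c (da i) (dh j) (dh l) * Re (cinner (\<phi> (da i) (dh j)) (dh l)))" for \<phi> :: "'a \<Rightarrow> 'h \<Rightarrow> 'h" and n
  have cpos: "c a h k > 0" for a h k unfolding c_def by (intro divide_pos_pos add_pos_nonneg) auto
  have cont: "continuous_map BW euclidean e"
  proof -
    have "continuous_map BW euclidean (\<lambda>\<phi>. e \<phi> n)" for n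
      unfolding e_def
      by (cases "from_nat n :: nat \<times> nat \<times> nat")
        (auto intro!: continuous_map_real_mult continuous_map_compose[OF continuous_map_matrix_coefficient, unfolded comp_def] continuous_intros)
    then show ?thesis
      by (metis continuous_map_componentwise_UNIV euclidean_product_topology)
  qed
  have inj: "inj_on e UCP"
  proof (rule inj_onI)
    fix \<phi> \<psi> :: "'a \<Rightarrow> 'h \<Rightarrow> 'h" assume \<phi>: "\<phi> \<in> UCP" and \<psi>: "\<psi> \<in> UCP" and "e \<phi> = e \<psi>"
    \<comment> \<open>Equality on the dense sequences is extended first in \<open>k\<close>, where
      real parts suffice, then in \<open>h\<close>, and finally in \<open>a\<close>.\<close>
    have "Re (cinner (\<phi> (da i) (dh j)) (dh l)) = Re (cinner (\<psi> (da i) (dh j)) (dh l))" for i j l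
      using fun_cong[OF \<open>e \<phi> = e \<psi>\<close>, of "to_nat (i, j, l)"] cpos[of "da i" "dh j" "dh l"] by (simp add: e_def)
    then have "\<phi> (da i) (dh j) - \<psi> (da i) (dh j) = 0" for i j
      by (intro cinner_eq_zero_if_dense[OF dh]) (auto simp: cinner_diff_left)
    then have eq: "cinner (\<phi> (da i) (dh j)) k = cinner (\<psi> (da i) (dh j)) k" for i j k by simp
    have eq2: "cinner (\<phi> (da i) h) k = cinner (\<psi> (da i) h) k" for i h k
    proof -
      have "(\<lambda>h. cinner (\<phi> (da i) h) k) = (\<lambda>h. cinner (\<psi> (da i) h) k)"
      proof (rule lipschitz_eq_on_dense[OF _ dh, where C = "16 * norm (da i) * norm k"])
        fix x y
        show "cmod (cinner (\<phi> (da i) x) k - cinner (\<phi> (da i) y) k) \<le> 16 * norm (da i) * norm k * norm (x - y)"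
          using UCP_bound[OF \<phi>, of "da i" "x - y" k] by (simp add: UCP_diff[OF \<phi>] cinner_diff_left mult_ac)
        show "cmod (cinner (\<psi> (da i) x) k - cinner (\<psi> (da i) y) k) \<le> 16 * norm (da i) * norm k * norm (x - y)"
          using UCP_bound[OF \<psi>, of "da i" "x - y" k] by (simp add: UCP_diff[OF \<psi>] cinner_diff_left mult_ac)
      qed (rule eq)
      then show ?thesis by meson
    qed
    have "cinner (\<phi> a h) k = cinner (\<psi> a h) k" for a h k
    proof -
      have "(\<lambda>a. cinner (\<phi> a h) k) = (\<lambda>a. cinner (\<psi> a h) k)"
      proof (rule lipschitz_eq_on_dense[OF _ da, where C = "16 * norm h * norm k"])
        fix x y
        show "cmod (cinner (\<phi> x h) k - cinner (\<phi> y h) k) \<le> 16 * norm h * norm k * norm (x - y)"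
          using UCP_bound[OF \<phi>, of "x - y" h k] by (simp add: UCP_diff[OF \<phi>] cinner_diff_left mult_ac)
        show "cmod (cinner (\<psi> x h) k - cinner (\<psi> y h) k) \<le> 16 * norm h * norm k * norm (x - y)"
          using UCP_bound[OF \<psi>, of "x - y" h k] by (simp add: UCP_diff[OF \<psi>] cinner_diff_left mult_ac)
      qed (rule eq2)
      then show ?thesis by meson
    qed
    then show "\<phi> = \<psi>" by (intro ext cinner_eq_imp_eq)
  qed
  have "homeomorphic_map BW (top_of_set (e ` UCP)) e"
  proof (rule continuous_imp_homeomorphic_map)
    show "continuous_map BW (top_of_set (e ` UCP)) e"
      using cont by (simp add: continuous_map_in_subtopology topspace_BW)
    show "Hausdorff_space (top_of_set (e ` UCP))" by (simp add: Hausdorff_space_subtopology)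
  qed (simp_all add: compact_space_BW topspace_BW inj)
  moreover have "\<bar>e \<phi> n\<bar> \<le> 1" if \<phi>: "\<phi> \<in> UCP" for \<phi> n
  proof -
    obtain i j l where n: "(from_nat n :: nat \<times> nat \<times> nat) = (i, j, l)" by (metis prod_cases3)
    have "\<bar>Re (cinner (\<phi> (da i) (dh j)) (dh l))\<bar> \<le> 1 + 16 * norm (da i) * norm (dh j) * norm (dh l)"
      using UCP_bound[OF \<phi>, of "da i" "dh j" "dh l"] abs_Re_le_cmod[of "cinner (\<phi> (da i) (dh j)) (dh l)"]
      by linarith
    moreover have "1 + 16 * norm (da i) * norm (dh j) * norm (dh l) > 0" by (intro add_pos_nonneg) auto
    ultimately show ?thesis by (simp add: e_def n c_def abs_mult abs_divide)
  qed
  moreover have "e (convex_comb t \<phi> \<psi>) n = t * e \<phi> n + (1 - t) * e \<psi> n" for t \<phi> \<psi> n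
    by (simp add: e_def convex_comb_def cinner_add_left cinner_scaleR_left distrib_left mult_ac split: prod.splits)
  ultimately show thesis using that inj by blast
qed

section \<open>Maximal measures on compact convex subsets of the Hilbert cube\<close>

definition comb :: "real \<Rightarrow> (nat \<Rightarrow> real) \<Rightarrow> (nat \<Rightarrow> real) \<Rightarrow> nat \<Rightarrow> real" where
  "comb t x y = (\<lambda>n. t * x n + (1 - t) * y n)"

text \<open>A weighted square norm. For unbounded sequences the series may diverge and
  \<open>suminf\<close> then carries no meaning, hence the coordinate bounds in the facts
  below.\<close>

definition energy :: "(nat \<Rightarrow> real) \<Rightarrow> real" where
  "energy x = (\<Sum>n. (1/2) ^ n * (x n)\<^sup>2)"

lemma summable_energy:
  assumes "\<And>n. \<bar>x n\<bar> \<le> B"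
  shows "summable (\<lambda>n. (1/2) ^ n * (x n)\<^sup>2 :: real)"
proof (rule summable_comparison_test'[where N = 0])
  show "summable (\<lambda>n. (1/2) ^ n * B\<^sup>2 :: real)" by (intro summable_mult2 summable_geometric) simp
  fix n
  have "(x n)\<^sup>2 \<le> B\<^sup>2" using assms[of n] by (metis abs_ge_zero order_trans power2_abs power_mono)
  then show "norm ((1/2) ^ n * (x n)\<^sup>2) \<le> (1/2) ^ n * B\<^sup>2" by simp
qed

lemma energy_nonneg:
  assumes "\<And>n. \<bar>x n\<bar> \<le> B"
  shows "0 \<le> energy x"
  unfolding energy_def by (intro suminf_nonneg summable_energy[OF assms]) simp

lemma energy_eq_0D:
  assumes "\<And>n. \<bar>x n\<bar> \<le> B" and "energy x = 0"
  shows "x n = 0"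
proof -
  have "\<forall>n. (1/2) ^ n * (x n)\<^sup>2 = 0"
    using assms(2) suminf_eq_zero_iff[OF summable_energy[OF assms(1)]] by (simp add: energy_def)
  then show ?thesis by simp
qed

text \<open>The identity holds for each squared coordinate. For \<open>0 < t < 1\<close> its last
  term is the strict convexity defect, which vanishes only if \<open>x = y\<close>.\<close>

lemma energy_comb:
  assumes "\<And>n. \<bar>x n\<bar> \<le> 1" "\<And>n. \<bar>y n\<bar> \<le> 1"
  shows "energy (comb t x y) = t * energy x + (1 - t) * energy y - t * (1 - t) * energy (\<lambda>n. x n - y n)"
proof -
  have "\<bar>x n - y n\<bar> \<le> 2" for n using assms[of n] by linarith
  then have s: "(\<lambda>n. (1/2) ^ n * (x n)\<^sup>2) sums energy x" "(\<lambda>n. (1/2) ^ n * (y n)\<^sup>2) sums energy y"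
    "(\<lambda>n. (1/2) ^ n * (x n - y n)\<^sup>2) sums energy (\<lambda>n. x n - y n)"
    unfolding energy_def
    using summable_energy[of x 1] summable_energy[of y 1] summable_energy[of "\<lambda>n. x n - y n" 2] assms
    by (simp_all only: summable_sums)
  have pointwise: "(1/2) ^ n * (comb t x y n)\<^sup>2 = t * ((1/2) ^ n * (x n)\<^sup>2)
      + (1 - t) * ((1/2) ^ n * (y n)\<^sup>2) - t * (1 - t) * ((1/2) ^ n * (x n - y n)\<^sup>2)" for n
  proof -
    have "(comb t x y n)\<^sup>2 = t * (x n)\<^sup>2 + (1 - t) * (y n)\<^sup>2 - t * (1 - t) * (x n - y n)\<^sup>2"
      by (simp add: comb_def power2_eq_square algebra_simps)
    then show ?thesis by (simp only: distrib_left right_diff_distrib mult_ac)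
  qed
  have "(\<lambda>n. (1/2) ^ n * (comb t x y n)\<^sup>2) sums
      (t * energy x + (1 - t) * energy y - t * (1 - t) * energy (\<lambda>n. x n - y n))"
    unfolding pointwise by (intro sums_diff sums_add sums_mult s)
  then show ?thesis by (simp add: energy_def sums_iff)
qed

lemma energy_scale: "energy (\<lambda>n. t * x n) = t\<^sup>2 * energy x" if "\<And>n. \<bar>x n\<bar> \<le> B"
  using suminf_mult[OF summable_energy[OF that], of "t\<^sup>2"]
  by (simp add: energy_def power_mult_distrib mult_ac)

lemma continuous_coordinate: "continuous_on S (\<lambda>x::nat \<Rightarrow> real. x n)"
  by (rule continuous_on_subset[OF continuous_on_product_coordinates]) simp

locale compact_convex_cube =
  fixes K :: "(nat \<Rightarrow> real) set"
  assumes compact: "compact K"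
    and cube: "x \<in> K \<Longrightarrow> \<bar>x n\<bar> \<le> 1"
    and convex: "\<lbrakk>x \<in> K; y \<in> K; 0 \<le> t; t \<le> 1\<rbrakk> \<Longrightarrow> comb t x y \<in> K"
begin

lemma continuous_energy: "continuous_on K energy"
proof -
  have "uniform_limit K (\<lambda>N x. \<Sum>n<N. (1/2) ^ n * (x n)\<^sup>2) (\<lambda>x. \<Sum>n. (1/2) ^ n * (x n)\<^sup>2) sequentially"
  proof (rule Weierstrass_m_test)
    show "summable (\<lambda>n. (1/2) ^ n :: real)" by (intro summable_geometric) simp
    fix n and x :: "nat \<Rightarrow> real" assume "x \<in> K"
    then have "(x n)\<^sup>2 \<le> 1" using cube[of x n] by (simp add: abs_square_le_1)
    then show "norm ((1/2) ^ n * (x n)\<^sup>2) \<le> (1/2) ^ n" by (simp add: mult_left_le)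
  qed
  moreover have "continuous_on K (\<lambda>x. \<Sum>n<N. (1/2) ^ n * (x n)\<^sup>2)" for N
    by (intro continuous_intros continuous_coordinate)
  ultimately have "continuous_on K (\<lambda>x. \<Sum>n. (1/2) ^ n * (x n)\<^sup>2)"
    by (intro uniform_limit_theorem[OF always_eventually]) auto
  then show ?thesis by (simp add: energy_def[abs_def])
qed

section \<open>Optimal midpoint decompositions and their measurability\<close>

definition fibre :: "(nat \<Rightarrow> real) \<Rightarrow> ((nat \<Rightarrow> real) \<times> (nat \<Rightarrow> real)) set" where
  "fibre x = {p \<in> K \<times> K. comb (1/2) (fst p) (snd p) = x}"

text \<open>The linear term rewards pulling the two halves apart in coordinate \<open>n\<close>,
  while the energies penalize separation and make the optimum unique.\<close>

definition payoff :: "nat \<Rightarrow> (nat \<Rightarrow> real) \<times> (nat \<Rightarrow> real) \<Rightarrow> real" where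
  "payoff n p = fst p n - energy (fst p) - energy (snd p)"

lemma continuous_midpoint:
  "continuous_on S (\<lambda>p::(nat \<Rightarrow> real) \<times> (nat \<Rightarrow> real). comb (1/2) (fst p) (snd p))"
proof (rule continuous_on_coordinatewise_then_product)
  fix n
  have "continuous_on S (\<lambda>p::(nat \<Rightarrow> real) \<times> (nat \<Rightarrow> real). fst p n)" for n
    by (rule continuous_on_product_then_coordinatewise) (intro continuous_on_fst continuous_on_id)
  moreover have "continuous_on S (\<lambda>p::(nat \<Rightarrow> real) \<times> (nat \<Rightarrow> real). snd p n)" for n
    by (rule continuous_on_product_then_coordinatewise) (intro continuous_on_snd continuous_on_id)
  ultimately show "continuous_on S (\<lambda>p. comb (1/2) (fst p) (snd p) n)"
    unfolding comb_def by (intro continuous_on_add continuous_on_mult_left)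
qed

lemma continuous_payoff: "continuous_on (K \<times> K) (payoff n)"
proof -
  have "continuous_on (K \<times> K) (\<lambda>p. fst p n)"
    by (rule continuous_on_product_then_coordinatewise) (intro continuous_on_fst continuous_on_id)
  moreover have "continuous_on (K \<times> K) (\<lambda>p. energy (fst p))"
    by (rule continuous_on_compose2[OF continuous_energy]) (auto intro: continuous_on_fst continuous_on_id)
  moreover have "continuous_on (K \<times> K) (\<lambda>p. energy (snd p))"
    by (rule continuous_on_compose2[OF continuous_energy]) (auto intro: continuous_on_snd continuous_on_id)
  ultimately show ?thesis unfolding payoff_def by (intro continuous_on_diff)
qed

text \<open>The closed set \<open>C\<close> allows the optimization to be restricted to pairs whose
  first half lies in a given closed set, as the measurability argument requires.\<close>

lemma compact_fibre_Int:
  assumes "closed C"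
  shows "compact (fibre x \<inter> C)"
proof -
  have "closed {p::(nat \<Rightarrow> real) \<times> (nat \<Rightarrow> real). comb (1/2) (fst p) (snd p) = x}"
    by (rule closed_Collect_eq[OF continuous_midpoint continuous_on_const])
  then have "compact ((K \<times> K) \<inter> ({p. comb (1/2) (fst p) (snd p) = x} \<inter> C))"
    by (intro compact_Int_closed compact_Times compact closed_Int assms)
  moreover have "(K \<times> K) \<inter> ({p. comb (1/2) (fst p) (snd p) = x} \<inter> C) = fibre x \<inter> C"
    unfolding fibre_def by blast
  ultimately show ?thesis by (simp only:)
qed

lemma payoff_attains_max:
  assumes "closed C" "fibre x \<inter> C \<noteq> {}"
  shows "\<exists>p\<in>fibre x \<inter> C. \<forall>q\<in>fibre x \<inter> C. payoff n q \<le> payoff n p"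
  by (intro continuous_attains_sup compact_fibre_Int assms
      continuous_on_subset[OF continuous_payoff]) (auto simp: fibre_def)

lemma fibre_diagonal: "x \<in> K \<Longrightarrow> (x, x) \<in> fibre x"
  by (auto simp: fibre_def comb_def)

text \<open>Outside \<open>K\<close> the fibre is empty by convexity and the choice is
  arbitrary.\<close>

definition splitting :: "nat \<Rightarrow> (nat \<Rightarrow> real) \<Rightarrow> (nat \<Rightarrow> real) \<times> (nat \<Rightarrow> real)" where
  "splitting n x = (SOME p. p \<in> fibre x \<and> (\<forall>q\<in>fibre x. payoff n q \<le> payoff n p))"

lemma splitting:
  assumes "x \<in> K"
  shows "splitting n x \<in> fibre x" and "q \<in> fibre x \<Longrightarrow> payoff n q \<le> payoff n (splitting n x)"
proof -
  have "\<exists>p. p \<in> fibre x \<and> (\<forall>q\<in>fibre x. payoff n q \<le> payoff n p)"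
  proof -
    have "fibre x \<inter> UNIV \<noteq> {}" using fibre_diagonal[OF assms] by auto
    from payoff_attains_max[OF closed_UNIV this, of n] show ?thesis by (simp add: Bex_def)
  qed
  from someI_ex[OF this] show "splitting n x \<in> fibre x"
    and "q \<in> fibre x \<Longrightarrow> payoff n q \<le> payoff n (splitting n x)"
    by (auto simp: splitting_def)
qed

lemma splitting_in:
  assumes "x \<in> K"
  shows "fst (splitting n x) \<in> K" "snd (splitting n x) \<in> K"
    and "comb (1/2) (fst (splitting n x)) (snd (splitting n x)) = x"
  using splitting(1)[OF assms, of n] by (auto simp: fibre_def)

text \<open>The average of \<open>p\<close> and the chosen pair stays in the fibre, and its payoff
  exceeds the mean of the two payoffs by a quarter of the energies of the differences. Optimality
  forces these energies to vanish.\<close>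

lemma splitting_unique:
  assumes "x \<in> K" "p \<in> fibre x" "payoff n (splitting n x) \<le> payoff n p"
  shows "fst p = fst (splitting n x)"
proof -
  obtain y z where p: "p = (y, z)" by fastforce
  obtain y' z' where p': "splitting n x = (y', z')" by fastforce
  have mem: "y \<in> K" "z \<in> K" "y' \<in> K" "z' \<in> K"
    using assms(2) splitting(1)[OF assms(1), of n] by (auto simp: p p' fibre_def)
  have mids: "comb (1/2) y z k = x k" "comb (1/2) y' z' k = x k" for k
    using assms(2) splitting(1)[OF assms(1), of n] by (auto simp: p p' fibre_def)
  have "comb (1/2) (comb (1/2) y y') (comb (1/2) z z') = x"
  proof
    fix k
    show "comb (1/2) (comb (1/2) y y') (comb (1/2) z z') k = x k"
      using mids[of k] by (simp add: comb_def field_simps)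
  qed
  then have "(comb (1/2) y y', comb (1/2) z z') \<in> fibre x"
    using convex[of y y' "1/2"] convex[of z z' "1/2"] mem by (simp add: fibre_def)
  from splitting(2)[OF assms(1) this, of n]
  have le: "payoff n (comb (1/2) y y', comb (1/2) z z') \<le> payoff n (y', z')" by (simp add: p')
  have b: "\<bar>u k - v k\<bar> \<le> 2" if "u \<in> K" "v \<in> K" for u v k
    using cube[OF that(1), of k] cube[OF that(2), of k] by linarith
  have "energy (\<lambda>k. y k - y' k) \<ge> 0" "energy (\<lambda>k. z k - z' k) \<ge> 0"
    by (rule energy_nonneg[of _ 2], intro b mem)+
  moreover have "payoff n (comb (1/2) y y', comb (1/2) z z') =
      (payoff n (y, z) + payoff n (y', z')) / 2
        + (energy (\<lambda>k. y k - y' k) + energy (\<lambda>k. z k - z' k)) / 4"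
  proof -
    have "comb (1/2) y y' n = (y n + y' n) / 2" by (simp add: comb_def field_simps)
    then show ?thesis
      using energy_comb[OF cube cube, OF mem(1,3), of "1/2"] energy_comb[OF cube cube, OF mem(2,4), of "1/2"]
      by (simp add: payoff_def field_simps)
  qed
  ultimately have "energy (\<lambda>k. y k - y' k) = 0"
    using le assms(3) unfolding p p' by (simp add: field_simps)
  then have "y k - y' k = 0" for k using energy_eq_0D[of "\<lambda>k. y k - y' k" 2 k, OF b[OF mem(1,3)]] by simp
  then show ?thesis by (auto simp: p p')
qed

text \<open>By uniqueness, the first half of the optimal pair lies in \<open>C\<close> exactly when
  restricting to pairs with first half in \<open>C\<close> does not lower the maximum. The points
  whose restricted maximum is at least \<open>q\<close> form a compact image \<open>A C q\<close>,
  and comparing the two maxima at rational \<open>q\<close> is a countable operation.\<close>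

lemma splitting_closed_preimage:
  assumes "closed C"
  shows "{x \<in> K. fst (splitting n x) \<in> C} \<in> sets borel"
proof -
  define A where "A C q = (\<lambda>p. comb (1/2) (fst p) (snd p)) `
      (((K \<times> K) \<inter> payoff n -` {q..}) \<inter> (C \<times> UNIV))" for C :: "(nat \<Rightarrow> real) set" and q
  have A: "A C q \<in> sets borel" if "closed C" for C q
  proof -
    have "closed ((K \<times> K) \<inter> payoff n -` {q..})"
      by (intro continuous_closed_preimage continuous_payoff closed_Times compact_imp_closed compact closed_atLeast)
    then have "compact ((K \<times> K) \<inter> (((K \<times> K) \<inter> payoff n -` {q..}) \<inter> (C \<times> UNIV)))"
      by (rule compact_Int_closed[OF compact_Times[OF compact compact]
            closed_Int[OF _ closed_Times[OF that closed_UNIV]]])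
    moreover have "(K \<times> K) \<inter> (((K \<times> K) \<inter> payoff n -` {q..}) \<inter> (C \<times> UNIV))
        = ((K \<times> K) \<inter> payoff n -` {q..}) \<inter> (C \<times> UNIV)" by blast
    ultimately have "compact (A C q)"
      unfolding A_def by (intro compact_continuous_image continuous_midpoint) simp
    then show ?thesis by (intro borel_closed compact_imp_closed)
  qed
  have A_iff: "x \<in> A C q \<longleftrightarrow> (\<exists>p\<in>fibre x. fst p \<in> C \<and> q \<le> payoff n p)" for x C q
    by (force simp: A_def fibre_def)
  have "{x \<in> K. fst (splitting n x) \<in> C} = K \<inter> (\<Inter>q\<in>\<rat>. - A UNIV q \<union> A C q)" (is "?L = ?R")
  proof (intro subset_antisym subsetI)
    fix x assume x: "x \<in> ?L"
    then have "x \<in> K" by simp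
    have "x \<in> A C q" if "x \<in> A UNIV q" for q
      using that splitting(1)[OF \<open>x \<in> K\<close>, of n] splitting(2)[OF \<open>x \<in> K\<close>, of _ n] x unfolding A_iff by (auto intro: order_trans)
    then show "x \<in> ?R" using \<open>x \<in> K\<close> by blast
  next
    fix x assume x: "x \<in> ?R"
    then have "x \<in> K" by simp
    have rat: "\<exists>p\<in>fibre x. fst p \<in> C \<and> q \<le> payoff n p"
      if "q \<in> \<rat>" "q \<le> payoff n (splitting n x)" for q
    proof -
      have "x \<in> A UNIV q" unfolding A_iff using splitting(1)[OF \<open>x \<in> K\<close>] that(2) by auto
      then show ?thesis using x that(1) unfolding A_iff[symmetric] by blast
    qed
    \<comment> \<open>One rational below the maximum already shows that the restricted fibre is
      nonempty, so a restricted maximizer exists.\<close>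
    obtain q0 where "q0 \<in> \<rat>" "q0 < payoff n (splitting n x)"
      using Rats_dense_in_real[of "payoff n (splitting n x) - 1" "payoff n (splitting n x)"] by auto
    with rat[of q0] have "fibre x \<inter> (C \<times> UNIV) \<noteq> {}" by (auto simp: mem_Times_iff)
    then obtain p where p: "p \<in> fibre x \<inter> (C \<times> UNIV)"
      and max: "\<And>q. q \<in> fibre x \<inter> (C \<times> UNIV) \<Longrightarrow> payoff n q \<le> payoff n p"
      using payoff_attains_max[of "C \<times> UNIV" x n] closed_Times[OF assms closed_UNIV] by blast
    have "payoff n (splitting n x) \<le> payoff n p"
    proof (rule ccontr)
      assume "\<not> ?thesis"
      then obtain q where q: "q \<in> \<rat>" "payoff n p < q" "q < payoff n (splitting n x)"
        using Rats_dense_in_real by (meson not_le)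
      then obtain p' where "p' \<in> fibre x" "fst p' \<in> C" "q \<le> payoff n p'" using rat[of q] by auto
      then show False using max[of p'] q by (auto simp: mem_Times_iff)
    qed
    then have "fst p = fst (splitting n x)" using splitting_unique[OF \<open>x \<in> K\<close>] p by blast
    then show "x \<in> ?L" using p \<open>x \<in> K\<close> by (auto simp: mem_Times_iff)
  qed
  also have "\<dots> \<in> sets borel"
    using A assms compact_imp_closed[OF compact] countable_rat
    by (intro sets.Int sets.countable_INT' sets.Un borel_closed)
      (auto intro!: Rats_0 borel_comp)
  finally show ?thesis .
qed

abbreviation BK :: "(nat \<Rightarrow> real) measure" where "BK \<equiv> restrict_space borel K"

lemma K_borel: "K \<in> sets borel"
  using compact by (simp add: compact_imp_closed)

lemma measurable_fst_splitting: "(\<lambda>x. fst (splitting n x)) \<in> measurable BK BK"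
proof (rule measurable_restrict_space2)
  show "(\<lambda>x. fst (splitting n x)) \<in> borel_measurable BK"
  proof (rule borel_measurableI)
    fix U :: "(nat \<Rightarrow> real) set" assume "open U"
    then have "K - {x \<in> K. fst (splitting n x) \<in> - U} \<in> sets borel"
      by (intro sets.Diff splitting_closed_preimage K_borel) auto
    moreover have "K - {x \<in> K. fst (splitting n x) \<in> - U} = (\<lambda>x. fst (splitting n x)) -` U \<inter> K" by auto
    ultimately show "(\<lambda>x. fst (splitting n x)) -` U \<inter> space BK \<in> sets BK"
      using K_borel by (simp add: sets_restrict_space_iff space_restrict_space)
  qed
qed (auto simp: space_restrict_space splitting_in)

text \<open>Since the midpoint is \<open>x\<close>, the second half is twice \<open>x\<close> minus
  the first half, and measurability is inherited coordinatewise.\<close>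

lemma measurable_snd_splitting: "(\<lambda>x. snd (splitting n x)) \<in> measurable BK BK"
proof (rule measurable_restrict_space2)
  have m: "(\<lambda>x. fst (splitting n x)) \<in> borel_measurable BK"
    using measurable_fst_splitting[of n] by (rule measurable_restrict_space2_iff[THEN iffD1, THEN conjunct1])
  have [measurable]: "(\<lambda>x. fst (splitting n x) k) \<in> borel_measurable BK" for k
    using measurable_compose[OF m, of "\<lambda>x. x k" borel]
    by (simp add: borel_measurable_continuous_onI continuous_coordinate)
  have [measurable]: "(\<lambda>x. x k) \<in> borel_measurable BK" for k
    by (intro borel_measurable_continuous_on_restrict continuous_coordinate)
  have "(\<lambda>x k. 2 * x k - fst (splitting n x) k) \<in> borel_measurable BK"
    by (rule measurable_coordinatewise_then_product) measurable
  moreover have "snd (splitting n x) k = 2 * x k - fst (splitting n x) k" if "x \<in> K" for x k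
    using fun_cong[OF splitting_in(3)[OF that, of n], of k] by (simp add: comb_def)
  ultimately show "(\<lambda>x. snd (splitting n x)) \<in> borel_measurable BK"
    by (subst measurable_cong[of _ _ "\<lambda>x k. 2 * x k - fst (splitting n x) k"])
      (auto simp: space_restrict_space fun_eq_iff)
qed (auto simp: space_restrict_space splitting_in)

end

section \<open>From maximality to extreme points\<close>

context compact_convex_cube
begin

lemma energy_midpoint:
  assumes "x \<in> K" "y \<in> K"
  shows "energy (comb (1/2) x y) = (energy x + energy y) / 2 - energy (\<lambda>n. x n - y n) / 4"
  using energy_comb[of x y "1/2"] cube assms by (simp add: field_simps)

text \<open>Shrinking a segment about \<open>x\<close> by a factor \<open>t\<close> changes the
  linear term of \<open>payoff n\<close> at first order in \<open>t\<close> but the energies only at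
  second order. Optimality of \<open>(x, x)\<close> thus excludes any first-order gain in coordinate
  \<open>n\<close>.\<close>

lemma splitting_fixed_imp_extreme:
  assumes "x \<in> K" and fixed: "\<And>n. splitting n x = (x, x)"
    and "y \<in> K" "z \<in> K" "comb (1/2) y z = x"
  shows "y = x"
proof -
  have half: "u n \<le> x n" if u: "u \<in> K" "v \<in> K" "comb (1/2) u v = x" for u v n
  proof (rule ccontr)
    assume "\<not> u n \<le> x n"
    define d where "d = u n - x n"
    define q where "q = energy (\<lambda>k. u k - v k)"
    have "\<bar>u k - v k\<bar> \<le> 2" for k using cube[OF u(1), of k] cube[OF u(2), of k] by linarith
    note q_scale = energy_scale[of "\<lambda>k. u k - v k" 2, OF this] and q_nonneg = energy_nonneg[of "\<lambda>k. u k - v k" 2, OF this]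
    \<comment> \<open>The shrunken pair gains \<open>t * d\<close> in coordinate \<open>n\<close>
      and loses \<open>t\<^sup>2 * q / 2\<close> in energy, so optimality gives
      \<open>t * d \<le> t\<^sup>2 * q / 2\<close>.\<close>
    have bound: "d \<le> t * q / 2" if t: "0 < t" "t \<le> 1" for t
    proof -
      have mem: "comb t u x \<in> K" "comb t v x \<in> K" using convex[of _ x t] assms(1) u t by auto
      have mid: "comb (1/2) (comb t u x) (comb t v x) = x"
      proof
        fix k
        have "u k + v k = 2 * x k" using fun_cong[OF u(3), of k] by (simp add: comb_def)
        then have "t * u k + t * v k = t * (2 * x k)" by (simp flip: distrib_left)
        then show "comb (1/2) (comb t u x) (comb t v x) k = x k"
          by (simp add: comb_def field_simps)
      qed
      then have "payoff n (comb t u x, comb t v x) \<le> payoff n (x, x)"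
        using splitting(2)[OF assms(1), of "(comb t u x, comb t v x)" n] mem
        by (simp add: fixed fibre_def)
      moreover have "energy (\<lambda>k. comb t u x k - comb t v x k) = t\<^sup>2 * q"
        using q_scale[of t] by (simp add: comb_def q_def right_diff_distrib)
      then have "energy x = (energy (comb t u x) + energy (comb t v x)) / 2 - t\<^sup>2 * q / 4"
        using energy_midpoint[OF mem] unfolding mid by (simp add: field_simps)
      ultimately have "t * d \<le> t * (t * q / 2)"
        by (simp add: payoff_def comb_def[of t u x] d_def power2_eq_square field_simps)
      then show ?thesis using t by simp
    qed
    have "d > 0" using \<open>\<not> u n \<le> x n\<close> by (simp add: d_def)
    \<comment> \<open>This choice gives \<open>t * q + t \<le> d\<close>, against
      \<open>d \<le> t * q / 2\<close>; the denominator \<open>q + 1\<close> also covers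
      \<open>q = 0\<close>.\<close>
    define t where "t = min 1 (d / (q + 1))"
    have q: "q \<ge> 0" using q_nonneg by (simp add: q_def)
    have t: "0 < t" "t \<le> 1" "t \<le> d / (q + 1)" using \<open>d > 0\<close> q by (auto simp: t_def)
    have "t * (q + 1) \<le> d" using t(3) q by (simp add: field_simps)
    moreover have "t * (q + 1) = t * q + t" "t * q \<ge> 0" using t q by (simp_all add: distrib_left)
    ultimately show False using bound[OF t(1,2)] t(1) by linarith
  qed
  \<comment> \<open>The roles of \<open>y\<close> and \<open>z\<close> are symmetric: neither
    exceeds \<open>x\<close> in any coordinate, yet their average is \<open>x\<close>.\<close>
  show ?thesis
  proof
    fix n
    have "y n + z n = 2 * x n" using fun_cong[OF assms(5), of n] by (simp add: comb_def)
    moreover have "comb (1/2) z y = x" using assms(5) by (auto simp: comb_def)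
    ultimately show "y n = x n" using half[OF assms(3-5), of n] half[OF assms(4,3), of n] by linarith
  qed
qed

text \<open>Domination alone fixes the barycenter, because an affine function and its negative are
  both convex; maximality can therefore be phrased by the order only.\<close>

theorem maximal_imp_AE_extreme:
  assumes "prob_space \<mu>" and sets: "sets \<mu> = sets BK"
    and maximal: "\<And>\<nu>. \<lbrakk>prob_space \<nu>; sets \<nu> = sets BK;
      \<And>F. \<lbrakk>continuous_on K F; \<And>x y t. \<lbrakk>x \<in> K; y \<in> K; 0 \<le> t; t \<le> 1\<rbrakk> \<Longrightarrow>
          F (comb t x y) \<le> t * F x + (1 - t) * F y\<rbrakk> \<Longrightarrow> (LINT x|\<mu>. F x) \<le> (LINT x|\<nu>. F x)\<rbrakk> \<Longrightarrow> \<nu> = \<mu>"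
  shows "AE x in \<mu>. \<forall>y\<in>K. \<forall>z\<in>K. comb (1/2) y z = x \<longrightarrow> y = x"
proof -
  interpret prob_space \<mu> by fact
  have space: "space \<mu> = K" using sets_eq_imp_space_eq[OF sets] by (simp add: space_restrict_space)
  have fixed: "AE x in \<mu>. splitting n x = (x, x)" for n
  proof -
    define S where "S x = fst (splitting n x)" for x
    define T where "T x = snd (splitting n x)" for x
    have [measurable]: "S \<in> measurable \<mu> BK" "T \<in> measurable \<mu> BK"
      unfolding S_def T_def measurable_cong_sets[OF sets refl]
      by (rule measurable_fst_splitting measurable_snd_splitting)+
    have ST: "S x \<in> K" "T x \<in> K" "comb (1/2) (S x) (T x) = x" if "x \<in> K" for x
      using splitting_in[OF that, of n] by (auto simp: S_def T_def)
    \<comment> \<open>A fair coin independent of \<open>x\<close> selects \<open>S x\<close> or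
      \<open>T x\<close>; the law \<open>\<nu>\<close> of the selected point is the average of the
      two image measures.\<close>
    let ?B = "measure_pmf (bernoulli_pmf (1/2))"
    let ?P = "?B \<Otimes>\<^sub>M \<mu>"
    interpret B: prob_space ?B by (rule prob_space_measure_pmf)
    interpret P: pair_prob_space ?B \<mu> ..
    define h where "h p = (if fst p then S (snd p) else T (snd p))" for p :: "bool \<times> (nat \<Rightarrow> real)"
    have [measurable]: "h \<in> measurable ?P BK" unfolding h_def by measurable
    define \<nu> where "\<nu> = distr ?P BK h"
    have F_facts: "F \<in> borel_measurable BK" "\<exists>C. \<forall>x\<in>K. norm (F x) \<le> C"
      if "continuous_on K F" for F :: "(nat \<Rightarrow> real) \<Rightarrow> real"
    proof -
      show "F \<in> borel_measurable BK" using that by (rule borel_measurable_continuous_on_restrict)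
      have "bounded (F ` K)" using that compact by (intro compact_imp_bounded compact_continuous_image)
      then show "\<exists>C. \<forall>x\<in>K. norm (F x) \<le> C" by (auto simp: bounded_iff)
    qed
    have integrable: "integrable \<mu> F" "integrable \<mu> (\<lambda>x. F (S x))" "integrable \<mu> (\<lambda>x. F (T x))"
      if F: "continuous_on K F" for F :: "(nat \<Rightarrow> real) \<Rightarrow> real"
    proof -
      note [measurable] = F_facts(1)[OF F]
      have [measurable]: "F \<in> borel_measurable \<mu>" using F_facts(1)[OF F] by (simp add: measurable_cong_sets[OF sets refl])
      obtain C where C: "\<forall>x\<in>K. norm (F x) \<le> C" using F_facts(2)[OF F] by blast
      show "integrable \<mu> F" "integrable \<mu> (\<lambda>x. F (S x))" "integrable \<mu> (\<lambda>x. F (T x))"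
        by (rule integrable_const_bound[where B = C], use C ST in \<open>auto simp: space intro!: AE_I2\<close>)+
    qed
    have integral: "(LINT x|\<nu>. F x) = (LINT x|\<mu>. (F (S x) + F (T x)) / 2)" if F: "continuous_on K F" for F :: "(nat \<Rightarrow> real) \<Rightarrow> real"
    proof -
      note [measurable] = F_facts(1)[OF F]
      obtain C where C: "\<forall>x\<in>K. norm (F x) \<le> C" using F_facts(2)[OF F] by blast
      have "integrable ?P (\<lambda>p. F (h p))"
        by (rule P.integrable_const_bound[where B = C])
          (use C ST in \<open>auto simp: h_def space space_pair_measure intro!: AE_I2\<close>)
      from P.integral_fst'[OF this]
      have "(LINT p|?P. F (h p)) = (LINT b|?B. LINT x|\<mu>. F (h (b, x)))" by simp
      also have "\<dots> = (LINT x|\<mu>. F (S x)) / 2 + (LINT x|\<mu>. F (T x)) / 2"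
        by (simp add: h_def)
      finally show ?thesis
        using integrable[OF F] by (simp add: \<nu>_def integral_distr add_divide_distrib)
    qed
    have "\<nu> = \<mu>"
    proof (rule maximal)
      show "prob_space \<nu>" unfolding \<nu>_def by (rule P.prob_space_distr) measurable
      show "sets \<nu> = sets BK" by (simp add: \<nu>_def)
      fix F assume F: "continuous_on K F" and
        conv: "\<And>x y t. \<lbrakk>x \<in> K; y \<in> K; 0 \<le> t; t \<le> 1\<rbrakk> \<Longrightarrow> F (comb t x y) \<le> t * F x + (1 - t) * F y"
      have "F x \<le> (F (S x) + F (T x)) / 2" if "x \<in> space \<mu>" for x
        using conv[of "S x" "T x" "1/2"] ST[of x] that by (simp add: space field_simps)
      then show "(LINT x|\<mu>. F x) \<le> (LINT x|\<nu>. F x)"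
        unfolding integral[OF F] using integrable[OF F] by (intro integral_mono) auto
    qed
    \<comment> \<open>Averaging over the halves leaves the integral of \<open>energy\<close>
      unchanged, while pointwise it can only increase \<open>energy\<close>, so the increase
      vanishes almost everywhere.\<close>
    then have zero: "(LINT x|\<mu>. (energy (S x) + energy (T x)) / 2 - energy x) = 0"
      using integral[OF continuous_energy] integrable[OF continuous_energy] by simp
    have eq: "(energy (S x) + energy (T x)) / 2 - energy x = energy (\<lambda>k. S x k - T x k) / 4"
      if "x \<in> K" for x
      using energy_midpoint[OF ST(1)[OF that] ST(2)[OF that]] by (simp add: ST(3)[OF that] field_simps)
    have bd: "\<bar>S x k - T x k\<bar> \<le> 2" if "x \<in> K" for x k
      using cube[OF ST(1)[OF that], of k] cube[OF ST(2)[OF that], of k] by linarith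
    have nonneg: "0 \<le> (energy (S x) + energy (T x)) / 2 - energy x" if "x \<in> K" for x
      using energy_nonneg[of "\<lambda>k. S x k - T x k" 2, OF bd[OF that]] unfolding eq[OF that] by simp
    have "integrable \<mu> (\<lambda>x. (energy (S x) + energy (T x)) / 2 - energy x)"
      using integrable[OF continuous_energy] by simp
    then have "AE x in \<mu>. (energy (S x) + energy (T x)) / 2 - energy x = 0"
      by (rule integral_nonneg_eq_0_iff_AE[THEN iffD1, OF _ _ zero]) (intro AE_I2 nonneg, simp add: space)
    then show ?thesis
    proof (rule AE_mp, intro AE_I2 impI)
      fix x assume "x \<in> space \<mu>" and 0: "(energy (S x) + energy (T x)) / 2 - energy x = 0"
      then have x: "x \<in> K" by (simp add: space)
      have "energy (\<lambda>k. S x k - T x k) = 0" using eq[OF x] 0 by simp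
      then have eqST: "S x k = T x k" for k using energy_eq_0D[of "\<lambda>k. S x k - T x k" 2 k] bd[OF x] by simp
      then have "S x k = x k" for k using fun_cong[OF ST(3)[OF x], of k] by (simp add: comb_def)
      with eqST have "S x = x" "T x = x" by (auto simp: fun_eq_iff)
      then show "splitting n x = (x, x)" unfolding S_def T_def by (metis prod.collapse)
    qed
  qed
  have "AE x in \<mu>. \<forall>n. splitting n x = (x, x)" using fixed by (simp add: AE_all_countable)
  then show ?thesis
    by (rule AE_mp, intro AE_I2 impI ballI) (use splitting_fixed_imp_extreme space in blast)
qed

text \<open>The points that are not extreme form a countable union of compact sets.\<close>

lemma extreme_borel: "{x \<in> K. \<forall>y\<in>K. \<forall>z\<in>K. comb (1/2) y z = x \<longrightarrow> y = x} \<in> sets borel"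
proof -
  \<comment> \<open>These are midpoints of pairs separated by at least \<open>1 / (m + 1)\<close> in
    coordinate \<open>n\<close>; a fixed gap keeps the set of pairs closed.\<close>
  define N where "N n m = (\<lambda>p. comb (1/2) (fst p) (snd p)) `
    ((K \<times> K) \<inter> {p. inverse (real (Suc m)) \<le> \<bar>fst p n - snd p n\<bar>})" for n m
  have "N n m \<in> sets borel" for n m
  proof -
    have "continuous_on UNIV (\<lambda>p::(nat \<Rightarrow> real) \<times> (nat \<Rightarrow> real). fst p n)"
      by (rule continuous_on_product_then_coordinatewise) (intro continuous_on_fst continuous_on_id)
    moreover have "continuous_on UNIV (\<lambda>p::(nat \<Rightarrow> real) \<times> (nat \<Rightarrow> real). snd p n)"
      by (rule continuous_on_product_then_coordinatewise) (intro continuous_on_snd continuous_on_id)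
    ultimately have "continuous_on UNIV (\<lambda>p::(nat \<Rightarrow> real) \<times> (nat \<Rightarrow> real). \<bar>fst p n - snd p n\<bar>)"
      by (intro continuous_on_rabs continuous_on_diff)
    then have "closed {p::(nat \<Rightarrow> real) \<times> (nat \<Rightarrow> real). inverse (real (Suc m)) \<le> \<bar>fst p n - snd p n\<bar>}"
      by (rule closed_Collect_le[OF continuous_on_const])
    then have "compact (N n m)"
      unfolding N_def by (rule compact_continuous_image[OF continuous_midpoint compact_Int_closed[OF compact_Times[OF compact compact]]])
    then show ?thesis by (intro borel_closed compact_imp_closed)
  qed
  moreover have "{x \<in> K. \<forall>y\<in>K. \<forall>z\<in>K. comb (1/2) y z = x \<longrightarrow> y = x} = K - (\<Union>n m. N n m)"
    (is "?L = ?R")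
  proof (intro subset_antisym subsetI)
    fix x assume x: "x \<in> ?L"
    have False if "x \<in> N n m" for n m
    proof -
      obtain y z where yz: "y \<in> K" "z \<in> K" "comb (1/2) y z = x" "inverse (real (Suc m)) \<le> \<bar>y n - z n\<bar>"
        using \<open>x \<in> N n m\<close> by (auto simp: N_def)
      then have "y n = x n" using x by auto
      moreover have "comb (1/2) y z n = x n" using yz by simp
      ultimately have "y n = z n" by (simp add: comb_def)
      then show False using yz(4) by simp
    qed
    then show "x \<in> ?R" using x by auto
  next
    fix x assume x: "x \<in> ?R"
    have "y = x" if yz: "y \<in> K" "z \<in> K" "comb (1/2) y z = x" for y z
    proof (rule ccontr)
      assume "y \<noteq> x"
      then obtain n where "y n \<noteq> x n" by (auto simp: fun_eq_iff)
      moreover have "y n + z n = 2 * x n" using fun_cong[OF yz(3), of n] by (simp add: comb_def)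
      ultimately have "0 < \<bar>y n - z n\<bar>" by auto
      then obtain m where "inverse (real (Suc m)) \<le> \<bar>y n - z n\<bar>"
        using reals_Archimedean less_imp_le by blast
      then have "x \<in> N n m" unfolding N_def using yz by (intro image_eqI[of _ _ "(y, z)"]) auto
      then show False using x by blast
    qed
    then show "x \<in> ?L" using x by blast
  qed
  ultimately show ?thesis using K_borel by auto
qed

end

section \<open>Convexity and extreme points\<close>

lemma UCP_convex:
  assumes \<phi>: "\<phi> \<in> UCP" and \<psi>: "\<psi> \<in> UCP" and t: "0 \<le> t" "t \<le> 1"
  shows "convex_comb t \<phi> \<psi> \<in> UCP"
proof -
  have comm: "r *\<^sub>R c *\<^sub>C x = c *\<^sub>C r *\<^sub>R x" for r c and x :: 'b
    by (simp add: scaleC_scaleR scaleC_scaleC mult.commute)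
  have scaleC_add: "c *\<^sub>C (x + y) = c *\<^sub>C x + c *\<^sub>C y" for c and x y :: 'b
    by (rule scaleC_add_right)
  have "bounded_clinear (convex_comb t \<phi> \<psi> a)" for a
  proof -
    obtain B C where B: "\<And>h. norm (\<phi> a h) \<le> B * norm h" and C: "\<And>h. norm (\<psi> a h) \<le> C * norm h"
    proof -
      have "bounded_clinear (\<phi> a)" "bounded_clinear (\<psi> a)"
        using \<phi> \<psi> by (auto simp: UCP_def completely_positive_def)
      then show thesis using that unfolding bounded_clinear_def by blast
    qed
    have "norm (convex_comb t \<phi> \<psi> a h) \<le> (t * B + (1 - t) * C) * norm h" for h
    proof -
      have "norm (convex_comb t \<phi> \<psi> a h) \<le> t * norm (\<phi> a h) + (1 - t) * norm (\<psi> a h)"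
        using norm_triangle_ineq[of "t *\<^sub>R \<phi> a h" "(1 - t) *\<^sub>R \<psi> a h"] t by (simp add: convex_comb_def)
      also have "\<dots> \<le> t * (B * norm h) + (1 - t) * (C * norm h)"
        using t B C by (intro add_mono mult_left_mono) auto
      finally show ?thesis by (simp add: algebra_simps)
    qed
    then show ?thesis
      unfolding bounded_clinear_def clinear_def
      by (auto simp: convex_comb_def UCP_clinear[OF \<phi>] UCP_clinear[OF \<psi>] scaleR_add_right comm scaleC_add)
  qed
  moreover have "positive_operator_matrix n (\<lambda>i j. convex_comb t \<phi> \<psi> (X i j))"
    if X: "positive_matrix n X" for n X
    unfolding positive_operator_matrix_def
  proof
    fix h
    define P where "P \<eta> = (\<Sum>i<n. cinner (\<Sum>j<n. \<eta> (X i j) (h j)) (h i))" for \<eta> :: "'a \<Rightarrow> 'b \<Rightarrow> 'b"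
    have "P \<phi> \<in> \<real>\<^sub>\<ge>\<^sub>0" "P \<psi> \<in> \<real>\<^sub>\<ge>\<^sub>0"
      using \<phi> \<psi> X unfolding UCP_def completely_positive_def positive_operator_matrix_def P_def by blast+
    then have "of_real t * P \<phi> + of_real (1 - t) * P \<psi> \<in> \<real>\<^sub>\<ge>\<^sub>0"
      using t by (intro nonneg_Reals_add_I nonneg_Reals_mult_I) (simp_all only: nonneg_Reals_of_real_iff diff_ge_0_iff_ge)
    moreover have "P (convex_comb t \<phi> \<psi>) = of_real t * P \<phi> + of_real (1 - t) * P \<psi>"
      unfolding P_def convex_comb_def
      by (simp only: cinner_sum_left cinner_add_left cinner_scaleR_left sum.distrib sum_distrib_left)
    ultimately show "(\<Sum>i<n. cinner (\<Sum>j<n. convex_comb t \<phi> \<psi> (X i j) (h j)) (h i)) \<in> \<real>\<^sub>\<ge>\<^sub>0"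
      by (simp add: P_def)
  qed
  ultimately show ?thesis
    by (auto simp: UCP_def completely_positive_def convex_comb_def UCP_add[OF \<phi>] UCP_add[OF \<psi>]
        UCP_scaleC[OF \<phi>] UCP_scaleC[OF \<psi>] UCP_one[OF \<phi>] UCP_one[OF \<psi>] scaleR_add_right comm scaleC_add
        simp flip: scaleR_left_distrib)
qed

lemma UCP_inv_convex:
  assumes "\<phi> \<in> UCP_inv G \<tau>" "\<psi> \<in> UCP_inv G \<tau>" "0 \<le> t" "t \<le> 1"
  shows "convex_comb t \<phi> \<psi> \<in> UCP_inv G \<tau>"
  using assms UCP_convex[of \<phi> \<psi> t] by (simp add: UCP_inv_def convex_comb_def)

text \<open>An interior point of a segment is the midpoint of a shorter segment inside it, so
  midpoints detect all proper convex combinations. This matches the extremality condition used in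
  the cube.\<close>

lemma extreme_points_iff_midpoint:
  assumes convex: "\<And>\<phi> \<psi> t. \<lbrakk>\<phi> \<in> S; \<psi> \<in> S; 0 \<le> t; t \<le> 1\<rbrakk> \<Longrightarrow> convex_comb t \<phi> \<psi> \<in> S"
  shows "\<phi> \<in> extreme_points S \<longleftrightarrow>
    \<phi> \<in> S \<and> (\<forall>\<phi>1\<in>S. \<forall>\<phi>2\<in>S. convex_comb (1/2) \<phi>1 \<phi>2 = \<phi> \<longrightarrow> \<phi>1 = \<phi>)"
proof (intro iffI conjI)
  assume ext: "\<phi> \<in> extreme_points S"
  then show "\<phi> \<in> S" by (simp add: extreme_points_def)
  show "\<forall>\<phi>1\<in>S. \<forall>\<phi>2\<in>S. convex_comb (1/2) \<phi>1 \<phi>2 = \<phi> \<longrightarrow> \<phi>1 = \<phi>"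
  proof (intro ballI impI)
    fix \<phi>1 \<phi>2 assume "\<phi>1 \<in> S" "\<phi>2 \<in> S" "convex_comb (1/2) \<phi>1 \<phi>2 = \<phi>"
    moreover have "(0::real) < 1/2 \<and> (1/2::real) < 1" by simp
    ultimately show "\<phi>1 = \<phi>" using ext unfolding extreme_points_def by blast
  qed
next
  assume R: "\<phi> \<in> S \<and> (\<forall>\<phi>1\<in>S. \<forall>\<phi>2\<in>S. convex_comb (1/2) \<phi>1 \<phi>2 = \<phi> \<longrightarrow> \<phi>1 = \<phi>)"
  have "\<phi>1 = \<phi> \<and> \<phi>2 = \<phi>"
    if S: "\<phi>1 \<in> S" "\<phi>2 \<in> S" and t: "0 < t" "t < 1" and eq: "\<phi> = convex_comb t \<phi>1 \<phi>2" for \<phi>1 \<phi>2 t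
  proof -
    \<comment> \<open>The largest \<open>d\<close> for which both \<open>t - d\<close> and
      \<open>t + d\<close> remain between 0 and 1.\<close>
    define d where "d = min t (1 - t)"
    have d: "0 < d" "d \<le> t" "d \<le> 1 - t" using t by (auto simp: d_def)
    have mem: "convex_comb (t + d) \<phi>1 \<phi>2 \<in> S" "convex_comb (t - d) \<phi>1 \<phi>2 \<in> S"
      using convex S d t by auto
    have "convex_comb (1/2) (convex_comb (t + d) \<phi>1 \<phi>2) (convex_comb (t - d) \<phi>1 \<phi>2) = \<phi>"
    proof (intro ext)
      fix a h
      have "(1/2) *\<^sub>R (p *\<^sub>R u + q *\<^sub>R v) + (1 - 1/2) *\<^sub>R (r *\<^sub>R u + s *\<^sub>R v)
          = ((1/2) * p + (1 - 1/2) * r) *\<^sub>R u + ((1/2) * q + (1 - 1/2) * s) *\<^sub>R v" for p q r s and u v :: 'b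
        by (simp only: scaleR_add_right scaleR_scaleR scaleR_add_left add_ac)
      moreover have "(1/2) * (t + d) + (1 - 1/2) * (t - d) = t"
        "(1/2) * (1 - (t + d)) + (1 - 1/2) * (1 - (t - d)) = 1 - t" by (simp_all add: field_simps)
      ultimately have "(1/2) *\<^sub>R ((t + d) *\<^sub>R u + (1 - (t + d)) *\<^sub>R v)
          + (1 - 1/2) *\<^sub>R ((t - d) *\<^sub>R u + (1 - (t - d)) *\<^sub>R v) = t *\<^sub>R u + (1 - t) *\<^sub>R v" for u v :: 'b
        by metis
      then show "convex_comb (1/2) (convex_comb (t + d) \<phi>1 \<phi>2) (convex_comb (t - d) \<phi>1 \<phi>2) a h = \<phi> a h"
        by (simp only: eq convex_comb_def)
    qed
    with R mem have "convex_comb (t + d) \<phi>1 \<phi>2 = convex_comb t \<phi>1 \<phi>2" unfolding eq by blast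
    then have "convex_comb (t + d) \<phi>1 \<phi>2 a h - convex_comb t \<phi>1 \<phi>2 a h = 0" for a h by simp
    moreover have "convex_comb (t + d) \<phi>1 \<phi>2 a h - convex_comb t \<phi>1 \<phi>2 a h = d *\<^sub>R (\<phi>1 a h - \<phi>2 a h)" for a h
      by (simp add: convex_comb_def algebra_simps)
    ultimately have "\<phi>1 = \<phi>2" using d by (intro ext) auto
    moreover have "convex_comb t \<phi>2 \<phi>2 = \<phi>2" by (simp add: convex_comb_def flip: scaleR_left_distrib)
    ultimately show ?thesis using eq by simp
  qed
  then show "\<phi> \<in> extreme_points S" using R unfolding extreme_points_def by blast
qed

lemma closedin_UCP_inv:
  "closedin BW (UCP_inv G \<tau> :: ('a::unital_cstar_algebra \<Rightarrow> 'h::complex_hilbert \<Rightarrow> 'h) set)"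
proof -
  define C where "C = (\<lambda>(g, a, h, k). {\<phi> :: 'a \<Rightarrow> 'h \<Rightarrow> 'h. \<phi> \<in> topspace BW \<and> cinner (\<phi> (\<tau> g a) h) k = cinner (\<phi> a h) k})"
  have "closedin BW (C p)" for p
    by (cases p) (auto simp: C_def intro!: closedin_continuous_maps_eq[OF Hausdorff_space_euclidean]
        continuous_map_matrix_coefficient)
  \<comment> \<open>Including \<open>topspace BW\<close> keeps the intersection inside
    \<open>UCP\<close> even when \<open>carrier G\<close> is empty.\<close>
  then have "closedin BW (\<Inter> (insert (topspace BW) (C ` (carrier G \<times> UNIV))))"
    by (intro closedin_Inter) auto
  also have "\<Inter> (insert (topspace BW) (C ` (carrier G \<times> UNIV))) = UCP_inv G \<tau>"
  proof (rule Set.set_eqI)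
    fix \<phi> :: "'a \<Rightarrow> 'h \<Rightarrow> 'h"
    have "\<phi> (\<tau> g a) = \<phi> a \<longleftrightarrow> (\<forall>h k. cinner (\<phi> (\<tau> g a) h) k = cinner (\<phi> a h) k)" for g a
      by (metis cinner_eq_imp_eq ext)
    then show "\<phi> \<in> \<Inter> (insert (topspace BW) (C ` (carrier G \<times> UNIV))) \<longleftrightarrow> \<phi> \<in> UCP_inv G \<tau>"
      by (auto simp: C_def UCP_inv_def topspace_BW)
  qed
  finally show ?thesis .
qed

section \<open>Borel measures on the space of UCP maps\<close>

locale BW_borel_probability = prob_space \<mu>
  for \<mu> :: "('a::unital_cstar_algebra \<Rightarrow> 'h::complex_hilbert \<Rightarrow> 'h) measure" +
  assumes space_eq: "space \<mu> = UCP" and sets_eq: "sets \<mu> = sigma_sets UCP {U. openin BW U}"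
begin

lemma openin_sets: "openin BW U \<Longrightarrow> U \<in> sets \<mu>"
  by (simp add: sets_eq)

lemma borel_measurable_continuous:
  assumes "continuous_map BW euclidean F"
  shows "F \<in> borel_measurable \<mu>"
proof (rule borel_measurableI)
  fix V :: "'b set" assume "open V"
  then have "openin BW {x \<in> topspace BW. F x \<in> V}"
    by (intro openin_continuous_map_preimage[OF assms]) simp
  then have "{x \<in> topspace BW. F x \<in> V} \<in> sets \<mu>" by (rule openin_sets)
  then show "F -` V \<inter> space \<mu> \<in> sets \<mu>"
    by (simp add: space_eq topspace_BW vimage_def Int_def conj_commute)
qed

lemma integrable_continuous:
  fixes F :: "_ \<Rightarrow> 'b::{banach, second_countable_topology}"
  assumes F: "continuous_map BW euclidean F"
  shows "integrable \<mu> F"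
proof -
  have "compactin euclidean (F ` UCP)"
    using image_compactin[OF _ F, of UCP] compact_space_BW by (simp add: compact_space_def topspace_BW)
  then have "bounded (F ` UCP)" by (simp add: compact_imp_bounded)
  then obtain C where "\<forall>x\<in>UCP. norm (F x) \<le> C" by (auto simp: bounded_iff)
  then show ?thesis
    by (intro integrable_const_bound[where B = C] borel_measurable_continuous[OF F] AE_I2) (simp add: space_eq)
qed

end

lemma measures_with_barycenter_iff:
  "\<mu> \<in> measures_with_barycenter \<phi> \<longleftrightarrow> BW_borel_probability \<mu> \<and>
    (\<forall>a h1 h2. cinner (\<phi> a h1) h2 = (LINT \<phi>'|\<mu>. cinner (\<phi>' a h1) h2))"
  by (auto simp: measures_with_barycenter_def BW_borel_probability_def BW_borel_probability_axioms_def)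

text \<open>The coordinate assumptions are the conclusions of \<open>BW_coordinates\<close>, fixed
  here together with a measure so that questions about it can be moved to the cube.\<close>

locale BW_coordinate_system = BW_borel_probability \<mu>
  for \<mu> :: "('a::unital_cstar_algebra \<Rightarrow> 'h::complex_hilbert \<Rightarrow> 'h) measure" +
  fixes e :: "('a \<Rightarrow> 'h \<Rightarrow> 'h) \<Rightarrow> nat \<Rightarrow> real"
  assumes homeomorphic: "homeomorphic_map BW (top_of_set (e ` UCP)) e"
    and inj: "inj_on e UCP"
    and bounded: "\<phi> \<in> UCP \<Longrightarrow> \<bar>e \<phi> n\<bar> \<le> 1"
    and affine: "e (convex_comb t \<phi> \<psi>) n = t * e \<phi> n + (1 - t) * e \<psi> n"
begin

lemma e_convex_comb: "e (convex_comb t \<phi> \<psi>) = comb t (e \<phi>) (e \<psi>)"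
  by (auto simp: comb_def affine)

text \<open>Affinity of \<open>e\<close> carries convexity to the image and compactness passes by
  continuity. The lemma serves both \<open>UCP\<close> itself and its invariant subset.\<close>

lemma compact_convex_cube_image:
  assumes "closedin BW S"
    and "\<And>\<phi> \<psi> t. \<lbrakk>\<phi> \<in> S; \<psi> \<in> S; 0 \<le> t; t \<le> 1\<rbrakk> \<Longrightarrow> convex_comb t \<phi> \<psi> \<in> S"
  shows "compact_convex_cube (e ` S)"
proof
  have S: "S \<subseteq> UCP" using closedin_subset[OF assms(1)] by (simp add: topspace_BW)
  have "compactin (top_of_set (e ` UCP)) (e ` S)"
    using image_compactin[OF closedin_compact_space[OF compact_space_BW assms(1)]
        homeomorphic_imp_continuous_map[OF homeomorphic]] .
  then show "compact (e ` S)" by (simp add: compactin_subtopology)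
  show "\<bar>x n\<bar> \<le> 1" if "x \<in> e ` S" for x n using that S bounded by auto
  show "comb t x y \<in> e ` S" if "x \<in> e ` S" "y \<in> e ` S" "0 \<le> t" "t \<le> 1" for x y t
    using that assms(2) by (auto simp flip: e_convex_comb)
qed

sublocale K: compact_convex_cube "e ` UCP"
  using closedin_topspace[of BW] UCP_convex
  by (intro compact_convex_cube_image) (auto simp: topspace_BW)

lemma measurable_e: "e \<in> measurable \<mu> K.BK"
proof (rule measurable_restrict_space2)
  have "continuous_map BW euclidean e"
    using homeomorphic_imp_continuous_map[OF homeomorphic] by (simp add: continuous_map_in_subtopology)
  then show "e \<in> borel_measurable \<mu>" by (rule borel_measurable_continuous)
qed (simp add: space_eq)

text \<open>Since \<open>e\<close> is injective and affine, the midpoint condition in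
  \<open>S\<close> is the preimage of the one in the image of \<open>S\<close>, which defines a
  Borel set.\<close>

lemma extreme_points_sets:
  assumes closed: "closedin BW S"
    and convex: "\<And>\<phi> \<psi> t. \<lbrakk>\<phi> \<in> S; \<psi> \<in> S; 0 \<le> t; t \<le> 1\<rbrakk> \<Longrightarrow> convex_comb t \<phi> \<psi> \<in> S"
  shows "extreme_points S \<in> sets \<mu>"
proof -
  interpret S: compact_convex_cube "e ` S" using assms by (rule compact_convex_cube_image)
  define X where "X = {x \<in> e ` S. \<forall>y\<in>e ` S. \<forall>z\<in>e ` S. comb (1/2) y z = x \<longrightarrow> y = x}"
  have S: "S \<subseteq> UCP" using closedin_subset[OF closed] by (simp add: topspace_BW)
  have eq_iff: "e \<phi> = e \<psi> \<longleftrightarrow> \<phi> = \<psi>" if "\<phi> \<in> S" "\<psi> \<in> S" for \<phi> \<psi>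
    using inj_on_eq_iff[OF inj] S that by blast
  have in_S: "\<phi> \<in> S" if "\<phi> \<in> UCP" "e \<phi> \<in> e ` S" for \<phi>
    using that S inj by (auto simp: inj_on_def)
  have "extreme_points S = e -` X \<inter> space \<mu>"
  proof (intro Set.set_eqI)
    fix \<phi>
    have "\<phi> \<in> extreme_points S \<longleftrightarrow>
        \<phi> \<in> S \<and> (\<forall>\<phi>1\<in>S. \<forall>\<phi>2\<in>S. convex_comb (1/2) \<phi>1 \<phi>2 = \<phi> \<longrightarrow> \<phi>1 = \<phi>)"
      by (rule extreme_points_iff_midpoint[OF convex])
    also have "\<dots> \<longleftrightarrow> \<phi> \<in> S \<and> (\<forall>\<phi>1\<in>S. \<forall>\<phi>2\<in>S. e (convex_comb (1/2) \<phi>1 \<phi>2) = e \<phi> \<longrightarrow> e \<phi>1 = e \<phi>)"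
      using eq_iff convex[of _ _ "1/2"] by auto
    also have "\<dots> \<longleftrightarrow> \<phi> \<in> e -` X \<inter> space \<mu>"
      using S in_S[of \<phi>] by (auto simp: X_def e_convex_comb space_eq)
    finally show "\<phi> \<in> extreme_points S \<longleftrightarrow> \<phi> \<in> e -` X \<inter> space \<mu>" .
  qed
  moreover have "X \<in> sets borel" unfolding X_def by (rule S.extreme_borel)
  moreover have "e \<in> borel_measurable \<mu>"
    using measurable_e by (rule measurable_restrict_space2_iff[THEN iffD1, THEN conjunct1])
  ultimately show ?thesis by (simp add: measurable_sets)
qed

text \<open>A point outside the support has a null open neighbourhood, which contains the preimage
  of a basic open set around its coordinates. Countably many such null preimages cover the
  complement of the support.\<close>

lemma AE_measure_support: "AE \<phi> in \<mu>. \<phi> \<in> measure_support \<mu>"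
proof -
  obtain B :: "(nat \<Rightarrow> real) set set" where B: "countable B" "topological_basis B"
    using ex_countable_basis by blast
  have cont: "continuous_map BW euclidean e"
    using homeomorphic_imp_continuous_map[OF homeomorphic] by (simp add: continuous_map_in_subtopology)
  have open_pre: "openin BW {\<phi> \<in> topspace BW. e \<phi> \<in> b}" if "b \<in> B" for b
    using topological_basis_open[OF B(2) that] by (intro openin_continuous_map_preimage[OF cont]) simp
  define N where "N = (\<Union>b\<in>{b \<in> B. emeasure \<mu> {\<phi> \<in> topspace BW. e \<phi> \<in> b} = 0}. {\<phi> \<in> topspace BW. e \<phi> \<in> b})"
  have "N \<in> null_sets \<mu>"
    unfolding N_def
  proof (rule null_sets_UN')
    show "countable {b \<in> B. emeasure \<mu> {\<phi> \<in> topspace BW. e \<phi> \<in> b} = 0}"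
      using B(1) by (rule countable_subset[rotated]) auto
  qed (use open_pre openin_sets in \<open>auto simp: null_sets_def\<close>)
  moreover have "{\<phi> \<in> space \<mu>. \<phi> \<notin> measure_support \<mu>} \<subseteq> N"
  proof
    fix \<phi> assume "\<phi> \<in> {\<phi> \<in> space \<mu>. \<phi> \<notin> measure_support \<mu>}"
    then obtain U where \<phi>: "\<phi> \<in> UCP" and U: "openin BW U" "\<phi> \<in> U" "emeasure \<mu> U = 0"
      by (auto simp: measure_support_def space_eq)
    have U_sub: "U \<subseteq> UCP" using openin_subset[OF U(1)] by (simp add: topspace_BW)
    then have "openin (top_of_set (e ` UCP)) (e ` U)"
      using homeomorphic_map_openness[OF homeomorphic, of U] U(1) by (simp add: topspace_BW)
    then obtain V where V: "open V" "e ` U = e ` UCP \<inter> V" by (auto simp: openin_open)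
    then have "e \<phi> \<in> V" using U(2) by blast
    then obtain b where b: "b \<in> B" "e \<phi> \<in> b" "b \<subseteq> V"
      using topological_basisE[OF B(2) V(1)] by metis
    have "{\<phi> \<in> topspace BW. e \<phi> \<in> b} \<subseteq> U"
    proof
      fix \<psi> assume "\<psi> \<in> {\<phi> \<in> topspace BW. e \<phi> \<in> b}"
      then have \<psi>: "\<psi> \<in> UCP" "e \<psi> \<in> e ` U" using V(2) b(3) by (auto simp: topspace_BW)
      then show "\<psi> \<in> U" using U_sub inj by (auto simp: inj_on_def)
    qed
    then have "emeasure \<mu> {\<phi> \<in> topspace BW. e \<phi> \<in> b} \<le> emeasure \<mu> U"
      by (intro emeasure_mono openin_sets U)
    then show "\<phi> \<in> N" using U(3) b \<phi> by (auto simp: N_def topspace_BW)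
  qed
  ultimately show ?thesis by (rule AE_I'[of N])
qed

text \<open>A measure on the cube that dominates the image of \<open>\<mu>\<close> pulls back along
  the inverse \<open>g\<close> of \<open>e\<close> to a measure dominating \<open>\<mu>\<close> with
  the same barycenter. Maximality of \<open>\<mu>\<close> thus transfers to its image.\<close>

lemma maximal_imp_AE_midpoint_extreme:
  assumes barycenter: "\<mu> \<in> measures_with_barycenter \<phi>" and maximal: "choquet_maximal \<phi> \<mu>"
  shows "AE \<psi> in \<mu>. \<forall>\<psi>1\<in>UCP. \<forall>\<psi>2\<in>UCP. convex_comb (1/2) \<psi>1 \<psi>2 = \<psi> \<longrightarrow> \<psi>1 = \<psi>"
proof -
  obtain g where g: "homeomorphic_maps BW (top_of_set (e ` UCP)) e g"
    using homeomorphic homeomorphic_map_maps by blast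
  have ge: "g (e \<psi>) = \<psi>" if "\<psi> \<in> UCP" for \<psi>
    using g that by (simp add: homeomorphic_maps_def topspace_BW)
  have g_cont: "continuous_map (top_of_set (e ` UCP)) BW g"
    using g by (simp add: homeomorphic_maps_def)
  have g_meas: "g \<in> measurable M \<mu>" if M: "sets M = sets K.BK" for M
  proof (rule measurable_sigma_sets[OF sets_eq])
    have space: "space M = e ` UCP" using sets_eq_imp_space_eq[OF M] by (simp add: space_restrict_space)
    show "{U. openin BW U} \<subseteq> Pow UCP" using openin_subset by (fastforce simp: topspace_BW)
    show "g \<in> space M \<rightarrow> UCP" using ge by (auto simp: space)
    fix U :: "('a \<Rightarrow> 'h \<Rightarrow> 'h) set" assume "U \<in> {U. openin BW U}"
    then have "openin (top_of_set (e ` UCP)) {x \<in> topspace (top_of_set (e ` UCP)). g x \<in> U}"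
      by (intro openin_continuous_map_preimage[OF g_cont]) simp
    then obtain V where "open V" "{x \<in> e ` UCP. g x \<in> U} = e ` UCP \<inter> V"
      by (auto simp: openin_open)
    moreover have "g -` U \<inter> space M = {x \<in> e ` UCP. g x \<in> U}" by (auto simp: space)
    ultimately show "g -` U \<inter> space M \<in> sets M"
      unfolding M sets_restrict_space_iff[of "e ` UCP" borel, simplified, OF K.K_borel]
      using K.K_borel by auto
  qed
  let ?\<mu>' = "distr \<mu> K.BK e"
  have "AE x in ?\<mu>'. \<forall>y\<in>e ` UCP. \<forall>z\<in>e ` UCP. comb (1/2) y z = x \<longrightarrow> y = x"
  proof (rule K.maximal_imp_AE_extreme)
    show "prob_space ?\<mu>'" by (rule prob_space_distr[OF measurable_e])
    show "sets ?\<mu>' = sets K.BK" by simp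
    fix \<nu>' assume \<nu>'_prob: "prob_space \<nu>'" and \<nu>'_sets: "sets \<nu>' = sets K.BK"
      and dominates: "\<And>F. \<lbrakk>continuous_on (e ` UCP) F; \<And>x y t. \<lbrakk>x \<in> e ` UCP; y \<in> e ` UCP; 0 \<le> t; t \<le> 1\<rbrakk> \<Longrightarrow>
          F (comb t x y) \<le> t * F x + (1 - t) * F y\<rbrakk> \<Longrightarrow> (LINT x|?\<mu>'. F x) \<le> (LINT x|\<nu>'. F x)"
    define \<nu> where "\<nu> = distr \<nu>' \<mu> g"
    interpret \<nu>: BW_borel_probability \<nu>
      unfolding BW_borel_probability_def BW_borel_probability_axioms_def
      using prob_space.prob_space_distr[OF \<nu>'_prob g_meas[OF \<nu>'_sets]] space_eq sets_eq by (simp add: \<nu>_def)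
    have mono: "(LINT \<psi>|\<mu>. F \<psi>) \<le> (LINT \<psi>|\<nu>. F \<psi>)"
      if F: "continuous_map BW euclideanreal F" "convex_on_UCP F" for F
    proof -
      have "(LINT x|?\<mu>'. F (g x)) \<le> (LINT x|\<nu>'. F (g x))"
      proof (rule dominates)
        show "continuous_on (e ` UCP) (\<lambda>x. F (g x))"
          using continuous_map_compose[OF g_cont F(1)] by (simp add: comp_def)
        show "F (g (comb t x y)) \<le> t * F (g x) + (1 - t) * F (g y)"
          if xy: "x \<in> e ` UCP" "y \<in> e ` UCP" and t: "0 \<le> t" "t \<le> 1" for x y t
        proof -
          obtain \<psi>1 \<psi>2 where \<psi>: "\<psi>1 \<in> UCP" "\<psi>2 \<in> UCP" "x = e \<psi>1" "y = e \<psi>2" using xy by blast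
          have "F (convex_comb t \<psi>1 \<psi>2) \<le> t * F \<psi>1 + (1 - t) * F \<psi>2"
            using F(2) \<psi> t by (simp add: convex_on_UCP_def)
          then show ?thesis
            using \<psi> t by (simp add: ge UCP_convex flip: e_convex_comb)
        qed
      qed
      moreover have "(LINT x|?\<mu>'. F (g x)) = (LINT \<psi>|\<mu>. F \<psi>)"
      proof -
        have "(\<lambda>x. F (g x)) \<in> borel_measurable K.BK"
          using measurable_compose[OF g_meas[OF refl] borel_measurable_continuous[OF F(1)]] .
        then have "(LINT x|?\<mu>'. F (g x)) = (LINT \<psi>|\<mu>. F (g (e \<psi>)))"
          by (rule integral_distr[OF measurable_e])
        also have "\<dots> = (LINT \<psi>|\<mu>. F \<psi>)"
          by (rule Bochner_Integration.integral_cong) (simp_all add: ge space_eq)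
        finally show ?thesis .
      qed
      moreover have "(LINT x|\<nu>'. F (g x)) = (LINT \<psi>|\<nu>. F \<psi>)"
        unfolding \<nu>_def using integral_distr[OF g_meas[OF \<nu>'_sets] borel_measurable_continuous[OF F(1)]] by simp
      ultimately show ?thesis by simp
    qed
    \<comment> \<open>For affine \<open>F\<close> both \<open>F\<close> and its negative are convex,
      so domination becomes equality; the matrix coefficients then yield the barycenter of
      \<open>\<nu>\<close>.\<close>
    have eq_affine: "(LINT \<psi>|\<mu>. F \<psi>) = (LINT \<psi>|\<nu>. F \<psi>)"
      if F: "continuous_map BW euclideanreal F"
        "\<And>t \<psi>1 \<psi>2. F (convex_comb t \<psi>1 \<psi>2) = t * F \<psi>1 + (1 - t) * F \<psi>2" for F
    proof (rule antisym)
      show "(LINT \<psi>|\<mu>. F \<psi>) \<le> (LINT \<psi>|\<nu>. F \<psi>)"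
        by (rule mono) (simp_all add: F convex_on_UCP_def)
      have "(LINT \<psi>|\<mu>. - F \<psi>) \<le> (LINT \<psi>|\<nu>. - F \<psi>)"
        by (rule mono) (simp_all add: F convex_on_UCP_def continuous_map_minus)
      then show "(LINT \<psi>|\<nu>. F \<psi>) \<le> (LINT \<psi>|\<mu>. F \<psi>)" by simp
    qed
    have "(LINT \<psi>|\<mu>. cinner (\<psi> a h) k) = (LINT \<psi>|\<nu>. cinner (\<psi> a h) k)" for a h k
    proof -
      have c: "continuous_map BW euclideanreal (\<lambda>\<psi>. Re (cinner (\<psi> a h) k))"
        "continuous_map BW euclideanreal (\<lambda>\<psi>. Im (cinner (\<psi> a h) k))"
        by (rule continuous_map_compose[OF continuous_map_matrix_coefficient, unfolded comp_def],
            simp add: continuous_on_Re continuous_on_Im continuous_on_id)+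
      have "(LINT \<psi>|\<mu>. Re (cinner (\<psi> a h) k)) = (LINT \<psi>|\<nu>. Re (cinner (\<psi> a h) k))"
        "(LINT \<psi>|\<mu>. Im (cinner (\<psi> a h) k)) = (LINT \<psi>|\<nu>. Im (cinner (\<psi> a h) k))"
        by (rule eq_affine[OF c(1)] eq_affine[OF c(2)],
            simp add: convex_comb_def cinner_add_left cinner_scaleR_left del: of_real_diff)+
      moreover note integrable_continuous[OF continuous_map_matrix_coefficient, of a h k]
        \<nu>.integrable_continuous[OF continuous_map_matrix_coefficient, of a h k]
      ultimately show ?thesis by (intro complex_eqI) (simp_all flip: integral_Re integral_Im)
    qed
    then have "\<nu> \<in> measures_with_barycenter \<phi>"
      using barycenter \<nu>.BW_borel_probability_axioms by (simp add: measures_with_barycenter_iff)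
    moreover have "choquet_ge \<nu> \<mu>" using mono by (simp add: choquet_ge_def)
    ultimately have "\<nu> = \<mu>" using maximal by (simp add: choquet_maximal_def)
    \<comment> \<open>Since \<open>e\<close> after \<open>g\<close> is the identity on the image of
      \<open>UCP\<close>, pushing \<open>\<nu>\<close> forward again recovers
      \<open>\<nu>'\<close>.\<close>
    then have "?\<mu>' = distr (distr \<nu>' \<mu> g) K.BK e" by (simp add: \<nu>_def)
    also have "\<dots> = distr \<nu>' K.BK (e \<circ> g)" by (rule distr_distr[OF measurable_e g_meas[OF \<nu>'_sets]])
    also have "\<dots> = distr \<nu>' K.BK (\<lambda>x. x)"
      using ge sets_eq_imp_space_eq[OF \<nu>'_sets] by (intro distr_cong) (auto simp: space_restrict_space)
    also have "\<dots> = \<nu>'" by (rule distr_id2) (simp add: \<nu>'_sets)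
    finally show "\<nu>' = ?\<mu>'" by simp
  qed
  from AE_distrD[OF measurable_e this]
  have "AE \<psi> in \<mu>. \<forall>y\<in>e ` UCP. \<forall>z\<in>e ` UCP. comb (1/2) y z = e \<psi> \<longrightarrow> y = e \<psi>" .
  then show ?thesis
  proof (rule AE_mp, intro AE_I2 impI ballI)
    fix \<psi> \<psi>1 \<psi>2
    assume *: "\<psi> \<in> space \<mu>" "\<forall>y\<in>e ` UCP. \<forall>z\<in>e ` UCP. comb (1/2) y z = e \<psi> \<longrightarrow> y = e \<psi>"
      "\<psi>1 \<in> UCP" "\<psi>2 \<in> UCP" "convex_comb (1/2) \<psi>1 \<psi>2 = \<psi>"
    then have "e \<psi>1 = e \<psi>" by (auto simp flip: e_convex_comb)
    then show "\<psi>1 = \<psi>" using inj * by (simp add: inj_on_def space_eq)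
  qed
qed

end

section \<open>Invariant UCP maps\<close>

context BW_borel_probability
begin

lemma UCP_inv_if_integrals_invariant:
  fixes \<tau> :: "'g \<Rightarrow> 'a \<Rightarrow> 'a"
  assumes "Group.group G"
    and integrals: "\<And>a h1 h2 g f. \<lbrakk>g \<in> carrier G; f \<in> L_infinity \<mu>\<rbrakk> \<Longrightarrow>
      (LINT \<psi>|\<mu>. f \<psi> * cinner (\<psi> (\<tau> (inv\<^bsub>G\<^esub> g) a) h1) h2) = (LINT \<psi>|\<mu>. f \<psi> * cinner (\<psi> a h1) h2)"
  shows "measure_support \<mu> \<subseteq> UCP_inv G \<tau>"
proof
  fix \<psi>0 assume supp: "\<psi>0 \<in> measure_support \<mu>"
  then have \<psi>0: "\<psi>0 \<in> UCP" by (simp add: measure_support_def)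
  have "\<psi>0 (\<tau> g a) h = \<psi>0 a h" if g: "g \<in> carrier G" for g a h
  proof (rule cinner_eq_imp_eq)
    fix k
    define p q where "p \<psi> = cinner (\<psi> (\<tau> g a) h) k" and "q \<psi> = cinner (\<psi> a h) k" for \<psi> :: "'a \<Rightarrow> 'h \<Rightarrow> 'h"
    \<comment> \<open>Bounded by \<open>UCP_bound\<close> and hence admissible; it turns the
      difference of the two integrands into the squared modulus of \<open>p - q\<close>.\<close>
    define f where "f \<psi> = cnj (p \<psi> - q \<psi>)" for \<psi>
    have cont: "continuous_map BW euclidean p" "continuous_map BW euclidean q"
      unfolding p_def q_def by (rule continuous_map_matrix_coefficient)+
    note [measurable] = borel_measurable_continuous[OF cont(1)] borel_measurable_continuous[OF cont(2)]
    define B where "B = 16 * norm (\<tau> g a) * norm h * norm k"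
    define C where "C = 16 * norm a * norm h * norm k"
    have p_le: "cmod (p \<psi>) \<le> B" and q_le: "cmod (q \<psi>) \<le> C" if "\<psi> \<in> UCP" for \<psi>
      unfolding p_def q_def B_def C_def by (rule UCP_bound[OF that])+
    have f_le: "cmod (f \<psi>) \<le> B + C" if "\<psi> \<in> UCP" for \<psi>
      using norm_triangle_ineq4[of "p \<psi>" "q \<psi>"] p_le[OF that] q_le[OF that]
      unfolding f_def complex_mod_cnj by linarith
    have [measurable]: "f \<in> borel_measurable \<mu>"
      unfolding f_def by (rule borel_measurable_continuous_on[of cnj])
        (intro continuous_on_cnj continuous_on_id, measurable)
    have "AE \<psi> in \<mu>. cmod (f \<psi>) \<le> B + C" by (rule AE_I2) (simp add: space_eq f_le)
    then have "f \<in> L_infinity \<mu>" unfolding L_infinity_def by auto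
    \<comment> \<open>The identity is taken at the inverse of \<open>g\<close>, whose own inverse is
      \<open>g\<close>.\<close>
    with integrals[of "inv\<^bsub>G\<^esub> g" f a h k] g assms(1)
    have eq: "(LINT \<psi>|\<mu>. f \<psi> * p \<psi>) = (LINT \<psi>|\<mu>. f \<psi> * q \<psi>)"
      by (simp add: group.inv_inv group.inv_closed p_def q_def)
    have BC: "B \<ge> 0" "C \<ge> 0" by (simp_all add: B_def C_def)
    have int: "integrable \<mu> (\<lambda>\<psi>. f \<psi> * p \<psi>)"
      using f_le p_le BC by (intro integrable_const_bound[where B = "(B + C) * B"])
        (auto simp: norm_mult space_eq intro!: AE_I2 mult_mono)
    have int': "integrable \<mu> (\<lambda>\<psi>. f \<psi> * q \<psi>)"
      using f_le q_le BC by (intro integrable_const_bound[where B = "(B + C) * C"])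
        (auto simp: norm_mult space_eq intro!: AE_I2 mult_mono)
    have sq: "f \<psi> * p \<psi> - f \<psi> * q \<psi> = complex_of_real ((cmod (p \<psi> - q \<psi>))\<^sup>2)" for \<psi>
      by (metis f_def complex_norm_square mult.commute right_diff_distrib)
    have "integrable \<mu> (\<lambda>\<psi>. complex_of_real ((cmod (p \<psi> - q \<psi>))\<^sup>2))"
      using Bochner_Integration.integrable_diff[OF int int'] by (simp add: sq)
    then have "integrable \<mu> (\<lambda>\<psi>. (cmod (p \<psi> - q \<psi>))\<^sup>2)"
      by (simp only: complex_of_real_integrable_eq)
    moreover have "(LINT \<psi>|\<mu>. (cmod (p \<psi> - q \<psi>))\<^sup>2) = 0"
    proof -
      have "(LINT \<psi>|\<mu>. complex_of_real ((cmod (p \<psi> - q \<psi>))\<^sup>2)) = 0"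
        using Bochner_Integration.integral_diff[OF int int'] eq by (simp add: sq)
      then show ?thesis by (simp only: integral_complex_of_real of_real_eq_0_iff)
    qed
    ultimately have "AE \<psi> in \<mu>. (cmod (p \<psi> - q \<psi>))\<^sup>2 = 0"
      by (subst (asm) integral_nonneg_eq_0_iff_AE) auto
    then have AE: "AE \<psi> in \<mu>. p \<psi> = q \<psi>" by simp
    \<comment> \<open>The set where \<open>p\<close> and \<open>q\<close> differ is open and null,
      so it contains no point of the support.\<close>
    have "openin BW (topspace BW - {\<psi> \<in> topspace BW. p \<psi> = q \<psi>})"
      by (intro openin_diff openin_topspace closedin_continuous_maps_eq[OF Hausdorff_space_euclidean] cont)
    moreover have "topspace BW - {\<psi> \<in> topspace BW. p \<psi> = q \<psi>} = {\<psi> \<in> UCP. p \<psi> \<noteq> q \<psi>}"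
      by (auto simp: topspace_BW)
    ultimately have op: "openin BW {\<psi> \<in> UCP. p \<psi> \<noteq> q \<psi>}" by simp
    have "emeasure \<mu> {\<psi> \<in> UCP. p \<psi> \<noteq> q \<psi>} = 0"
      using AE AE_iff_measurable[OF openin_sets[OF op], of "\<lambda>\<psi>. p \<psi> = q \<psi>"] by (simp add: space_eq)
    then have "\<psi>0 \<notin> {\<psi> \<in> UCP. p \<psi> \<noteq> q \<psi>}"
      using supp op unfolding measure_support_def by fastforce
    then show "cinner (\<psi>0 (\<tau> g a) h) k = cinner (\<psi>0 a h) k" using \<psi>0 by (simp add: p_def q_def)
  qed
  then show "\<psi>0 \<in> UCP_inv G \<tau>" using \<psi>0 by (auto simp: UCP_inv_def)
qed

end

section \<open>Invariance on the support, and extremality under maximality\<close>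

theorem proposition3p4:
  fixes G :: "('g, 'm) monoid_scheme"
    and \<tau> :: "'g \<Rightarrow> 'a::unital_cstar_algebra \<Rightarrow> 'a"
    and \<phi> :: "'a \<Rightarrow> 'h::complex_hilbert \<Rightarrow> 'h"
    and \<mu> :: "('a \<Rightarrow> 'h \<Rightarrow> 'h) measure"
  assumes "separable_space (euclidean :: 'a topology)"
    and "separable_space (euclidean :: 'h topology)"
    and "Group.group G"
    and "action_by_automorphisms G \<tau>"
    and "\<phi> \<in> UCP_inv G \<tau>"
    and "\<mu> \<in> orthogonal_measures \<phi>"
  shows "((\<forall>a b h1 h2. \<forall>g\<in>carrier G. \<forall>f\<in>L_infinity \<mu>.
             (LINT \<phi>'|\<mu>. f \<phi>' * cinner (\<phi>' (\<tau> (inv\<^bsub>G\<^esub> g) (a * b)) h1) h2) =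
             (LINT \<phi>'|\<mu>. f \<phi>' * cinner (\<phi>' (a * b) h1) h2))
          \<longleftrightarrow> measure_support \<mu> \<subseteq> UCP_inv G \<tau>) \<and>
         (measure_support \<mu> \<subseteq> UCP_inv G \<tau> \<and> choquet_maximal \<phi> \<mu>
          \<longrightarrow> supported_on \<mu> (extreme_points (UCP_inv G \<tau>)))"
proof -
  have bary: "\<mu> \<in> measures_with_barycenter \<phi>" using assms(6) by (simp add: orthogonal_measures_def)
  then interpret BW_borel_probability \<mu> by (simp add: measures_with_barycenter_iff)
  obtain e :: "('a \<Rightarrow> 'h \<Rightarrow> 'h) \<Rightarrow> nat \<Rightarrow> real" where "BW_coordinate_system \<mu> e"
    using BW_coordinates[OF assms(1,2)] BW_borel_probability_axioms
    unfolding BW_coordinate_system_def BW_coordinate_system_axioms_def by metis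
  then interpret BW_coordinate_system \<mu> e .
  have AE_inv: "AE \<psi> in \<mu>. \<psi> \<in> UCP_inv G \<tau>" if "measure_support \<mu> \<subseteq> UCP_inv G \<tau>"
    using AE_measure_support by (rule AE_mp) (use that in auto)
  show ?thesis
  proof (intro conjI iffI impI allI ballI)
    assume L: "\<forall>a b h1 h2. \<forall>g\<in>carrier G. \<forall>f\<in>L_infinity \<mu>.
             (LINT \<phi>'|\<mu>. f \<phi>' * cinner (\<phi>' (\<tau> (inv\<^bsub>G\<^esub> g) (a * b)) h1) h2) =
             (LINT \<phi>'|\<mu>. f \<phi>' * cinner (\<phi>' (a * b) h1) h2)"
    show "measure_support \<mu> \<subseteq> UCP_inv G \<tau>"
    proof (rule UCP_inv_if_integrals_invariant[OF assms(3)])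
      fix a h1 h2 g f assume "g \<in> carrier G" "f \<in> L_infinity \<mu>"
      \<comment> \<open>Taking \<open>b = 1\<close> reaches every element of the algebra as a
        product.\<close>
      with L have "(LINT \<phi>'|\<mu>. f \<phi>' * cinner (\<phi>' (\<tau> (inv\<^bsub>G\<^esub> g) (a * 1)) h1) h2) =
             (LINT \<phi>'|\<mu>. f \<phi>' * cinner (\<phi>' (a * 1) h1) h2)" by blast
      then show "(LINT \<psi>|\<mu>. f \<psi> * cinner (\<psi> (\<tau> (inv\<^bsub>G\<^esub> g) a) h1) h2) = (LINT \<psi>|\<mu>. f \<psi> * cinner (\<psi> a h1) h2)"
        by simp
    qed
  next
    fix a b h1 h2 g f
    assume supp: "measure_support \<mu> \<subseteq> UCP_inv G \<tau>" and g: "g \<in> carrier G" and f: "f \<in> L_infinity \<mu>"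
    have f_meas: "f \<in> borel_measurable \<mu>" using f by (simp add: L_infinity_def)
    have inv: "inv\<^bsub>G\<^esub> g \<in> carrier G" using g assms(3) by (simp add: group.inv_closed)
    show "(LINT \<phi>'|\<mu>. f \<phi>' * cinner (\<phi>' (\<tau> (inv\<^bsub>G\<^esub> g) (a * b)) h1) h2) =
          (LINT \<phi>'|\<mu>. f \<phi>' * cinner (\<phi>' (a * b) h1) h2)"
    proof (rule integral_cong_AE)
      show "AE \<phi>' in \<mu>. f \<phi>' * cinner (\<phi>' (\<tau> (inv\<^bsub>G\<^esub> g) (a * b)) h1) h2 = f \<phi>' * cinner (\<phi>' (a * b) h1) h2"
        using AE_inv[OF supp] by (rule AE_mp) (use inv in \<open>auto simp: UCP_inv_def intro!: AE_I2\<close>)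
    qed (intro borel_measurable_times f_meas borel_measurable_continuous continuous_map_matrix_coefficient)+
  next
    assume "measure_support \<mu> \<subseteq> UCP_inv G \<tau> \<and> choquet_maximal \<phi> \<mu>"
    then have supp: "measure_support \<mu> \<subseteq> UCP_inv G \<tau>" and maximal: "choquet_maximal \<phi> \<mu>" by auto
    have ext_sets: "extreme_points (UCP_inv G \<tau>) \<in> sets \<mu>"
      by (rule extreme_points_sets[OF closedin_UCP_inv UCP_inv_convex])
    \<comment> \<open>Since \<open>UCP_inv G \<tau>\<close> lies in \<open>UCP\<close>, an invariant
      map with no nontrivial midpoint decomposition in \<open>UCP\<close> has none among invariant
      maps.\<close>
    have "AE \<psi> in \<mu>. \<psi> \<in> extreme_points (UCP_inv G \<tau>)"
      using AE_inv[OF supp] maximal_imp_AE_midpoint_extreme[OF bary maximal]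
    proof eventually_elim
      case (elim \<psi>)
      show ?case
      proof (rule extreme_points_iff_midpoint[THEN iffD2])
        show "convex_comb t \<psi>1 \<psi>2 \<in> UCP_inv G \<tau>"
          if "\<psi>1 \<in> UCP_inv G \<tau>" "\<psi>2 \<in> UCP_inv G \<tau>" "0 \<le> t" "t \<le> 1" for \<psi>1 \<psi>2 t
          using that by (rule UCP_inv_convex)
      qed (use elim in \<open>auto simp: UCP_inv_def\<close>)
    qed
    then show "supported_on \<mu> (extreme_points (UCP_inv G \<tau>))"
      unfolding supported_on_def using ext_sets emeasure_eq_1_AE by blast
  qed
qed

end
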